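(* Let $I_1=I_2\in\mathbb R$, $\kappa>0$ and $a\in\mathbb R$, and consider the drift Hamiltonian $$H_{\mathrm{drift}}=\tfrac12I_1(\pi_1^2+\pi_2^2)+\tfrac12I_2\pi_3^2+\kappa(\pi_1x_1+\pi_2x_2)+a\pi_3$$ on $\mathbb R^2\times T^*SO(3)=\{(x,A,\pi)\}$ with symmetry group $SO(3)\times S^1$, and its reduced systems on the reduced spaces $M_{j_1,j_2}\subset\mathbb R^3=\{(w_1,w_2,\pi_3)\}$ described in the context. Then the orbits of the reduced system on $M_{j_1,j_2}$ lie in the intersections of $M_{j_1,j_2}$ with the planes $\frac{\kappa}{2}w_2+a\pi_3=\text{constant}$, and: (i) if $j_1>0$, $j_2<j_1$ and $j_2\ne-j_1$ (so $M_{j_1,j_2}$ is a smooth sphere), the reduced flow has exactly two equilibria, both stable; (ii) if $-j_2=j_1>0$ (so $M_{j_1,j_2}$ is a topological sphere with one conical singularity at $(0,0,j_1)$) and $a^2<4\kappa^2j_1$, then the singularity is an unstable equilibrium with a single homoclinic connection to it, and there are exactly two other equilibria, both stable; (iii) if $-j_2=j_1>0$ and $a^2\ge4\kappa^2j_1$, then there are exactly two equilibria, both stable, one of which is at the singularity.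
   Context: $\mathbb R^2$ has symplectic form $dx_1\wedge dx_2$ and $T^*SO(3)\cong SO(3)\times\mathbb R^3$ by left trivialization. $SO(3)$ acts by left translation on the factor $A$; $S^1$ acts by $\theta\cdot(x,A,\pi)=(R_\theta x,AR_\theta^{-1},R_\theta\pi)$, where $R_\theta$ is counterclockwise rotation (about the third axis on $\mathbb R^3$). After reduction by $SO(3)$ the equations on $\{(x,\pi)\}$ are $$\dot\pi=\pi\times\Omega,\quad \dot x_1=\kappa\pi_2,\quad\dot x_2=-\kappa\pi_1,\qquad \Omega=(I_1\pi_1+\kappa x_1,\,I_1\pi_2+\kappa x_2,\,I_2\pi_3+a),$$ with conserved quantities $j_1=|\pi|$ and $j_2=-\frac12(x_1^2+x_2^2)-\pi_3$. With $w_1=2(x_1\pi_2-x_2\pi_1)$ and $w_2=2(x_1\pi_1+x_2\pi_2)$, the quotient by $S^1$ of the set of $(x,\pi)$ with given values $j_1\ge0$, $j_2\le j_1$ is identified via $(w_1,w_2,\pi_3)$ with $$M_{j_1,j_2}=\{w_1^2+w_2^2=8(\pi_3^2-j_1^2)(\pi_3+j_2),\ -j_1\le\pi_3\le\min(j_1,-j_2)\}\subset\mathbb R^3,$$ and the reduced flow is the flow induced on this quotient. Stability is meant on the reduced space. *)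

theory Defs
  imports "HOL-Analysis.Analysis"
begin

unbundle cross3_syntax

section \<open>The drift Hamiltonian and its symmetries\<close>

text \<open>A point \<open>(x, A, p)\<close> stands for an element of \<open>\<real>\<^sup>2 \<times> SO(3) \<times> \<real>\<^sup>3\<close>, the left
  trivialization of \<open>\<real>\<^sup>2 \<times> T\<^sup>*SO(3)\<close>; the body momentum \<open>\<pi>\<close> is called \<open>p\<close>.\<close>

type_synonym phase = "(real^2) \<times> (real^3^3) \<times> (real^3)"
type_synonym state = "(real^2) \<times> (real^3)"

definition drift_hamiltonian :: "real \<Rightarrow> real \<Rightarrow> real \<Rightarrow> real \<Rightarrow> phase \<Rightarrow> real" where
  "drift_hamiltonian I1 I2 \<kappa> a = (\<lambda>(x, A, p).
     1/2 * I1 * ((p$1)\<^sup>2 + (p$2)\<^sup>2) + 1/2 * I2 * (p$3)\<^sup>2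
     + \<kappa> * (p$1 * x$1 + p$2 * x$2) + a * p$3)"

definition rot2 :: "real \<Rightarrow> real^2^2" where
  "rot2 \<theta> = vector [vector [cos \<theta>, - sin \<theta>], vector [sin \<theta>, cos \<theta>]]"

definition rot3 :: "real \<Rightarrow> real^3^3" where
  "rot3 \<theta> = vector [vector [cos \<theta>, - sin \<theta>, 0], vector [sin \<theta>, cos \<theta>, 0], vector [0, 0, 1]]"

definition SO3_action :: "real^3^3 \<Rightarrow> phase \<Rightarrow> phase" where
  "SO3_action B = (\<lambda>(x, A, p). (x, B ** A, p))"

definition circle_action :: "real \<Rightarrow> phase \<Rightarrow> phase" where
  "circle_action \<theta> = (\<lambda>(x, A, p). (rot2 \<theta> *v x, A ** matrix_inv (rot3 \<theta>), rot3 \<theta> *v p))"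

text \<open>The circle action induced on the quotient by \<open>SO(3)\<close>.\<close>

definition circle_action_state :: "real \<Rightarrow> state \<Rightarrow> state" where
  "circle_action_state \<theta> = (\<lambda>(x, p). (rot2 \<theta> *v x, rot3 \<theta> *v p))"

section \<open>Reduction by \<open>SO(3)\<close>\<close>

text \<open>A function invariant under left translation of \<open>A\<close> is determined by its values at
  \<open>A = 1\<close>.\<close>

definition SO3_reduced :: "(phase \<Rightarrow> real) \<Rightarrow> state \<Rightarrow> real" where
  "SO3_reduced H = (\<lambda>(x, p). H (x, mat 1, p))"

text \<open>Hamilton's equations on \<open>\<real>\<^sup>2 \<times> so(3)\<^sup>*\<close>: symplectic form \<open>dx\<^sub>1 \<and> dx\<^sub>2\<close> on the first
  factor and the (left) Lie--Poisson equation \<open>p' = p \<times> \<partial>h/\<partial>p\<close> on the second one. For the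
  drift Hamiltonian, \<open>hamiltonian_field_drift\<close> below gives the components.\<close>

definition hamiltonian_field :: "(state \<Rightarrow> real) \<Rightarrow> state \<Rightarrow> state" where
  "hamiltonian_field h u =
     (let D = frechet_derivative h (at u) in
      (vector [D (axis 2 1, 0), - D (axis 1 1, 0)],
       snd u \<times> (\<chi> i. D (0, axis i 1))))"

definition is_solution :: "(state \<Rightarrow> real) \<Rightarrow> (real \<Rightarrow> state) \<Rightarrow> bool" where
  "is_solution h u \<longleftrightarrow>
     (\<forall>t. (u has_vector_derivative hamiltonian_field h (u t)) (at t))"

definition J1 :: "state \<Rightarrow> real" where
  "J1 = (\<lambda>(x, p). norm p)"

definition J2 :: "state \<Rightarrow> real" where
  "J2 = (\<lambda>(x, p). - 1/2 * ((x$1)\<^sup>2 + (x$2)\<^sup>2) - p$3)"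

definition momentum_level :: "real \<Rightarrow> real \<Rightarrow> state set" where
  "momentum_level j1 j2 = {u. J1 u = j1 \<and> J2 u = j2}"

section \<open>Reduction by the circle\<close>

text \<open>The invariants \<open>(w\<^sub>1, w\<^sub>2, \<pi>\<^sub>3)\<close>.\<close>

definition circle_reduction :: "state \<Rightarrow> real^3" where
  "circle_reduction = (\<lambda>(x, p).
     vector [2 * (x$1 * p$2 - x$2 * p$1), 2 * (x$1 * p$1 + x$2 * p$2), p$3])"

definition reduced_space :: "real \<Rightarrow> real \<Rightarrow> (real^3) set" where
  "reduced_space j1 j2 =
     {w. (w$1)\<^sup>2 + (w$2)\<^sup>2 = 8 * ((w$3)\<^sup>2 - j1\<^sup>2) * (w$3 + j2)
         \<and> - j1 \<le> w$3 \<and> w$3 \<le> min j1 (- j2)}"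

text \<open>The trajectories of the reduced flow are the images of the solution curves in the momentum
  level. By \<open>circle_reduction_image\<close> and \<open>circle_reduction_fibres\<close> below, \<open>circle_reduction\<close>
  identifies the orbit space of the (compact) momentum level with the reduced space.\<close>

definition reduced_trajectory ::
  "(phase \<Rightarrow> real) \<Rightarrow> real \<Rightarrow> real \<Rightarrow> (real \<Rightarrow> real^3) \<Rightarrow> bool" where
  "reduced_trajectory H j1 j2 c \<longleftrightarrow>
     (\<exists>u. is_solution (SO3_reduced H) u \<and> range u \<subseteq> momentum_level j1 j2
          \<and> c = circle_reduction \<circ> u)"

definition equilibria :: "(phase \<Rightarrow> real) \<Rightarrow> real \<Rightarrow> real \<Rightarrow> (real^3) set" where
  "equilibria H j1 j2 =
     {m \<in> reduced_space j1 j2. reduced_trajectory H j1 j2 (\<lambda>t. m)}"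

text \<open>Lyapunov stability within the reduced space.\<close>

definition lyapunov_stable :: "(phase \<Rightarrow> real) \<Rightarrow> real \<Rightarrow> real \<Rightarrow> real^3 \<Rightarrow> bool" where
  "lyapunov_stable H j1 j2 m \<longleftrightarrow>
     (\<forall>e>0. \<exists>d>0. \<forall>c. reduced_trajectory H j1 j2 c \<longrightarrow> dist (c 0) m < d \<longrightarrow>
        (\<forall>t\<ge>0. dist (c t) m < e))"

definition homoclinic_orbit ::
  "(phase \<Rightarrow> real) \<Rightarrow> real \<Rightarrow> real \<Rightarrow> real^3 \<Rightarrow> (real^3) set \<Rightarrow> bool" where
  "homoclinic_orbit H j1 j2 m X \<longleftrightarrow>
     (\<exists>c. reduced_trajectory H j1 j2 c \<and> (\<forall>t. c t \<noteq> m)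
          \<and> (c \<longlongrightarrow> m) at_top \<and> (c \<longlongrightarrow> m) at_bot \<and> X = range c)"

section \<open>Surfaces in \<open>\<real>\<^sup>3\<close>\<close>

text \<open>\<open>C\<^sup>\<infinity>\<close> functions on an open set \<open>U\<close>: differentiable, with all directional derivatives again
  \<open>C\<^sup>\<infinity>\<close>.\<close>

coinductive smooth_on ::
  "(real^3) set \<Rightarrow> (real^3 \<Rightarrow> 'b::real_normed_vector) \<Rightarrow> bool" for U where
  "(\<And>x. x \<in> U \<Longrightarrow> (f has_derivative f' x) (at x)) \<Longrightarrow>
   (\<And>v. smooth_on U (\<lambda>x. f' x v)) \<Longrightarrow> smooth_on U f"

text \<open>A smooth point of \<open>S\<close>: near it, \<open>S\<close> is a regular level set.\<close>

definition smooth_surface_at :: "(real^3) set \<Rightarrow> real^3 \<Rightarrow> bool" where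
  "smooth_surface_at S p \<longleftrightarrow>
     (\<exists>U (f :: real^3 \<Rightarrow> real). open U \<and> p \<in> U \<and> smooth_on U f
        \<and> S \<inter> U = {x \<in> U. f x = 0} \<and> frechet_derivative f (at p) \<noteq> (\<lambda>v. 0))"

definition topological_sphere :: "(real^3) set \<Rightarrow> bool" where
  "topological_sphere S \<longleftrightarrow> S homeomorphic sphere (0 :: real^3) 1"

definition smooth_sphere :: "(real^3) set \<Rightarrow> bool" where
  "smooth_sphere S \<longleftrightarrow> topological_sphere S \<and> (\<forall>p\<in>S. smooth_surface_at S p)"

text \<open>A conical singularity of \<open>S\<close>: a local diffeomorphism of the ambient space takes \<open>S\<close> to a
  circular half-cone with apex the image of the singular point.\<close>

definition conical_singularity :: "(real^3) set \<Rightarrow> real^3 \<Rightarrow> bool" where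
  "conical_singularity S p \<longleftrightarrow>
     (\<exists>U V \<phi> \<psi>. open U \<and> open V \<and> p \<in> U \<and> \<phi> p = 0
        \<and> homeomorphism U V \<phi> \<psi> \<and> smooth_on U \<phi> \<and> smooth_on V \<psi>
        \<and> \<phi> ` (S \<inter> U) = {y \<in> V. y$3 = sqrt ((y$1)\<^sup>2 + (y$2)\<^sup>2)})"

definition sphere_with_conical_singularity :: "(real^3) set \<Rightarrow> real^3 \<Rightarrow> bool" where
  "sphere_with_conical_singularity S p \<longleftrightarrow>
     topological_sphere S \<and> p \<in> S \<and> conical_singularity S p
     \<and> (\<forall>q\<in>S - {p}. smooth_surface_at S q)"

section \<open>Consistency of the definitions\<close>

lemma drift_hamiltonian_SO3_invariant:
  "drift_hamiltonian I1 I2 \<kappa> a (SO3_action B u) = drift_hamiltonian I1 I2 \<kappa> a u"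
  by (simp add: drift_hamiltonian_def SO3_action_def split: prod.splits)

lemma rot2_mult: "rot2 \<theta> *v x = vector [cos \<theta> * x$1 - sin \<theta> * x$2, sin \<theta> * x$1 + cos \<theta> * x$2]"
  by (simp add: vec_eq_iff forall_2 rot2_def matrix_vector_mult_def sum_2)

lemma rot3_mult:
  "rot3 \<theta> *v p = vector [cos \<theta> * p$1 - sin \<theta> * p$2, sin \<theta> * p$1 + cos \<theta> * p$2, p$3]"
  by (simp add: vec_eq_iff forall_3 rot3_def matrix_vector_mult_def sum_3)

lemma rotation_inner:
  fixes c s a b x y :: real
  assumes "s\<^sup>2 + c\<^sup>2 = 1"
  shows "(c * a - s * b) * (c * x - s * y) + (s * a + c * b) * (s * x + c * y) = a * x + b * y"
proof -
  have "(c * a - s * b) * (c * x - s * y) + (s * a + c * b) * (s * x + c * y)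
      = (s\<^sup>2 + c\<^sup>2) * (a * x + b * y)"
    by algebra
  then show ?thesis using assms by simp
qed

lemma rotation_norm:
  fixes c s a b :: real
  assumes "s\<^sup>2 + c\<^sup>2 = 1"
  shows "(c * a - s * b)\<^sup>2 + (s * a + c * b)\<^sup>2 = a\<^sup>2 + b\<^sup>2"
  using rotation_inner[OF assms, of a b a b] by (simp add: power2_eq_square)

lemma rotation_area:
  fixes c s a b x y :: real
  assumes "s\<^sup>2 + c\<^sup>2 = 1"
  shows "(c * a - s * b) * (s * x + c * y) - (s * a + c * b) * (c * x - s * y) = a * y - b * x"
proof -
  have "(c * a - s * b) * (s * x + c * y) - (s * a + c * b) * (c * x - s * y)
      = (s\<^sup>2 + c\<^sup>2) * (a * y - b * x)"
    by algebra
  then show ?thesis using assms by simp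
qed

lemma drift_hamiltonian_circle_invariant:
  "drift_hamiltonian I1 I2 \<kappa> a (circle_action \<theta> u) = drift_hamiltonian I1 I2 \<kappa> a u"
  by (simp add: drift_hamiltonian_def circle_action_def rot2_mult rot3_mult rotation_norm
      rotation_inner split: prod.splits)

lemma hamiltonian_field_drift:
  fixes I1 I2 \<kappa> a :: real and x :: "real^2" and p :: "real^3"
  defines "\<Omega> \<equiv> (vector [I1 * p$1 + \<kappa> * x$1, I1 * p$2 + \<kappa> * x$2, I2 * p$3 + a] :: real^3)"
  shows "hamiltonian_field (SO3_reduced (drift_hamiltonian I1 I2 \<kappa> a)) (x, p) =
    (vector [\<kappa> * p$2, - \<kappa> * p$1], p \<times> \<Omega>)"
proof -
  let ?h = "SO3_reduced (drift_hamiltonian I1 I2 \<kappa> a)"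
  let ?D = "\<lambda>v::state. I1 * (p$1 * snd v$1 + p$2 * snd v$2) + I2 * p$3 * snd v$3
     + \<kappa> * (p$1 * fst v$1 + snd v$1 * x$1 + p$2 * fst v$2 + snd v$2 * x$2) + a * snd v$3"
  have fst_der: "((\<lambda>u::state. fst u$i) has_derivative (\<lambda>v. fst v$i)) (at (x, p))" for i
    by (intro bounded_linear_imp_has_derivative
        bounded_linear_compose[OF bounded_linear_vec_nth bounded_linear_fst])
  have snd_der: "((\<lambda>u::state. snd u$i) has_derivative (\<lambda>v. snd v$i)) (at (x, p))" for i
    by (intro bounded_linear_imp_has_derivative
        bounded_linear_compose[OF bounded_linear_vec_nth bounded_linear_snd])
  have h: "?h = (\<lambda>u. 1/2 * I1 * ((snd u$1)\<^sup>2 + (snd u$2)\<^sup>2) + 1/2 * I2 * (snd u$3)\<^sup>2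
     + \<kappa> * (snd u$1 * fst u$1 + snd u$2 * fst u$2) + a * snd u$3)"
    by (simp add: SO3_reduced_def drift_hamiltonian_def fun_eq_iff)
  have "(?h has_derivative ?D) (at (x, p))"
    unfolding h
    by (rule derivative_eq_intros fst_der snd_der refl)+ (simp add: fun_eq_iff algebra_simps)
  then have D: "frechet_derivative ?h (at (x, p)) = ?D"
    by (rule frechet_derivative_at[symmetric])
  show ?thesis
    unfolding hamiltonian_field_def D Let_def \<Omega>_def
    by (simp add: vec_eq_iff forall_2 forall_3 axis_def cross3_simps)
qed

lemma momentum_level_iff:
  "(x, p) \<in> momentum_level j1 j2 \<longleftrightarrow> 
     j1 \<ge> 0 \<and> (p$1)\<^sup>2 + (p$2)\<^sup>2 + (p$3)\<^sup>2 = j1\<^sup>2 \<and> (x$1)\<^sup>2 + (x$2)\<^sup>2 = - 2 * (p$3 + j2)"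
proof -
  have n: "(norm p)\<^sup>2 = (p$1)\<^sup>2 + (p$2)\<^sup>2 + (p$3)\<^sup>2"
    by (simp add: norm_vec_def L2_set_def sum_3)
  have "norm p = j1 \<longleftrightarrow> j1 \<ge> 0 \<and> (norm p)\<^sup>2 = j1\<^sup>2"
    using norm_ge_zero power2_eq_iff_nonneg by blast
  then show ?thesis
    unfolding n by (auto simp: momentum_level_def J1_def J2_def field_simps)
qed

lemma momentum_level_circle_invariant:
  "circle_action_state \<theta> u \<in> momentum_level j1 j2 \<longleftrightarrow> u \<in> momentum_level j1 j2"
  by (cases u) (simp add: circle_action_state_def momentum_level_iff rot2_mult rot3_mult
      rotation_norm)

lemma circle_reduction_invariant:
  "circle_reduction (circle_action_state \<theta> u) = circle_reduction u"
  by (cases u) (simp add: circle_action_state_def circle_reduction_def rot2_mult rot3_mult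
      rotation_inner rotation_area del: distrib_left_numeral right_diff_distrib_numeral)

lemma vec3_eqI: "v$1 = a \<Longrightarrow> v$2 = b \<Longrightarrow> v$3 = c \<Longrightarrow> v = (vector [a, b, c] :: real^3)"
  by (simp add: vec_eq_iff forall_3)

lemma circle_reduction_image:
  assumes "j1 \<ge> 0"
  shows "circle_reduction ` momentum_level j1 j2 = reduced_space j1 j2"
proof (intro equalityI subsetI)
  fix w assume "w \<in> circle_reduction ` momentum_level j1 j2"
  then obtain x p where xp: "(x, p) \<in> momentum_level j1 j2" and w: "w = circle_reduction (x, p)"
    by auto
  from xp have p: "(p$1)\<^sup>2 + (p$2)\<^sup>2 = j1\<^sup>2 - (p$3)\<^sup>2"
    and x: "(x$1)\<^sup>2 + (x$2)\<^sup>2 = - 2 * (p$3 + j2)"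
    by (auto simp: momentum_level_iff)
  have "(w$1)\<^sup>2 + (w$2)\<^sup>2 = 4 * ((x$1)\<^sup>2 + (x$2)\<^sup>2) * ((p$1)\<^sup>2 + (p$2)\<^sup>2)"
    unfolding w circle_reduction_def by simp algebra
  also have "\<dots> = 8 * ((p$3)\<^sup>2 - j1\<^sup>2) * (p$3 + j2)"
    unfolding p x by algebra
  finally have 1: "(w$1)\<^sup>2 + (w$2)\<^sup>2 = 8 * ((w$3)\<^sup>2 - j1\<^sup>2) * (w$3 + j2)"
    by (simp add: w circle_reduction_def)
  have "(p$3)\<^sup>2 \<le> j1\<^sup>2"
    using p by (smt (verit) zero_le_power2)
  then have 2: "\<bar>p$3\<bar> \<le> j1"
    using assms by (simp add: abs_le_square_iff[symmetric])
  have 3: "p$3 \<le> - j2"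
    using x by (smt (verit) zero_le_power2)
  show "w \<in> reduced_space j1 j2"
    using 1 2 3 by (auto simp: reduced_space_def w circle_reduction_def)
next
  fix w assume w: "w \<in> reduced_space j1 j2"
  define r where "r = sqrt (j1\<^sup>2 - (w$3)\<^sup>2)"
  define s where "s = sqrt (- 2 * (w$3 + j2))"
  have "\<bar>w$3\<bar> \<le> j1" and le: "w$3 + j2 \<le> 0"
    using w by (auto simp: reduced_space_def)
  then have "(w$3)\<^sup>2 \<le> j1\<^sup>2"
    using power_mono[of "\<bar>w$3\<bar>" j1 2] by simp
  then have r: "r\<^sup>2 = j1\<^sup>2 - (w$3)\<^sup>2" by (simp add: r_def)
  have s: "s\<^sup>2 = - 2 * (w$3 + j2)" using le by (simp add: s_def)
  have eq: "(w$1)\<^sup>2 + (w$2)\<^sup>2 = 4 * s\<^sup>2 * r\<^sup>2"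
    using w unfolding r s by (simp add: reduced_space_def algebra_simps)
  have "\<exists>u\<in>momentum_level j1 j2. w = circle_reduction u"
  proof (cases "s = 0")
    case True
    then have "w$1 = 0" "w$2 = 0"
      using eq by (simp_all add: sum_power2_eq_zero_iff)
    then show ?thesis
      using True r s assms
      by (intro bexI[of _ "(0, vector [r, 0, w$3])"])
        (auto simp: circle_reduction_def momentum_level_iff vec_eq_iff forall_3)
  next
    case False
    have "(w$2 / (2 * s))\<^sup>2 + (w$1 / (2 * s))\<^sup>2 = ((w$1)\<^sup>2 + (w$2)\<^sup>2) / (4 * s\<^sup>2)"
      by (simp add: power_divide power_mult_distrib add_divide_distrib)
    also have "\<dots> = r\<^sup>2"
      unfolding eq using False by simp
    finally show ?thesis
      using False r s assms
      by (intro bexI[of _ "(vector [s, 0], vector [w$2 / (2 * s), w$1 / (2 * s), w$3])"])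
        (auto simp: circle_reduction_def momentum_level_iff vec_eq_iff forall_3)
  qed
  then show "w \<in> circle_reduction ` momentum_level j1 j2" by blast
qed

lemma circle_reduction_fibres:
  assumes u: "u \<in> momentum_level j1 j2" and v: "v \<in> momentum_level j1 j2"
  shows "circle_reduction u = circle_reduction v \<longleftrightarrow> (\<exists>\<theta>. v = circle_action_state \<theta> u)"
proof
  assume eq: "circle_reduction u = circle_reduction v"
  obtain x p y q where uv: "u = (x, p)" "v = (y, q)"
    by (metis surj_pair)
  define X P Y Q where "X = Complex (x$1) (x$2)" and "P = Complex (p$1) (p$2)"
    and "Y = Complex (y$1) (y$2)" and "Q = Complex (q$1) (q$2)"
  have eq': "x$1 * p$2 - x$2 * p$1 = y$1 * q$2 - y$2 * q$1"
    "x$1 * p$1 + x$2 * p$2 = y$1 * q$1 + y$2 * q$2" and 3: "p$3 = q$3"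
    using eq by (simp_all add: uv circle_reduction_def vec_eq_iff forall_3)
  have XP: "cnj X * P = cnj Y * Q"
    using eq' by (simp add: X_def P_def Y_def Q_def complex_eq_iff algebra_simps)
  have nX: "cmod X = cmod Y" and nP: "cmod P = cmod Q"
    using u v 3 unfolding uv momentum_level_iff
    by (auto simp: X_def P_def Y_def Q_def cmod_def)
  have rot: "\<exists>\<theta>. Z' = cis \<theta> * Z" if "cmod Z = cmod Z'" "Z \<noteq> 0" for Z Z' :: complex
  proof -
    have "Z' \<noteq> 0" using that by (metis norm_eq_zero)
    then have "cmod (Z' / Z) = 1" using that by (simp add: norm_divide)
    then have "Z' / Z = cis (Arg (Z' / Z))"
      using rcis_cmod_Arg[of "Z' / Z"] by (simp add: rcis_def)
    then have "Z' = cis (Arg (Z' / Z)) * Z"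
      using that(2) by (metis nonzero_eq_divide_eq)
    then show ?thesis by blast
  qed
  have "\<exists>\<theta>. Y = cis \<theta> * X \<and> Q = cis \<theta> * P"
  proof (cases "X = 0")
    case True
    then have "Y = 0" using nX by simp
    then show ?thesis using True rot[of P Q] nP by (cases "P = 0") auto
  next
    case False
    then obtain \<theta> where \<theta>: "Y = cis \<theta> * X" using rot[OF nX] by blast
    then have "cnj X * P = cnj X * (cnj (cis \<theta>) * Q)" using XP by (simp add: mult_ac)
    then have "P = cnj (cis \<theta>) * Q" using False by simp
    then have "cis \<theta> * P = Q" by (simp add: cis_cnj cis_mult flip: mult.assoc)
    then show ?thesis using \<theta> by blast
  qed
  then obtain \<theta> where "Y = cis \<theta> * X" "Q = cis \<theta> * P" by blast
  then have "v = circle_action_state \<theta> u"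
    using 3 by (simp add: uv circle_action_state_def rot2_mult rot3_mult vec_eq_iff forall_2
        forall_3 X_def P_def Y_def Q_def complex_eq_iff)
  then show "\<exists>\<theta>. v = circle_action_state \<theta> u" ..
qed (auto simp: circle_reduction_invariant)

end

theory Submission
  imports Defs
begin

text \<open>For \<open>I1 = I2 = I\<close> the quadratic part of the Hamiltonian is the Casimir \<open>I/2 |\<pi>|\<^sup>2\<close>, and
  \<open>\<pi> \<times> I\<pi> = 0\<close>. What remains of the flow descends to the invariants \<open>w\<close>: writing \<open>z = w$3\<close> and
  \<open>F(z) = 8 (z\<^sup>2 - j1\<^sup>2) (z + j2)\<close> (\<open>profile\<close>),
  \<open>w1' = - (\<kappa>/4 F'(z) + a w2)\<close>, \<open>w2' = a w1\<close>, \<open>z' = - \<kappa>/2 w1\<close>,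
  so that \<open>\<kappa>/2 w2 + a z\<close> is conserved, and the orbits lie in planes \<open>w2 + \<lambda> z = const\<close> with
  \<open>\<lambda> = 2a/\<kappa>\<close>.

  The reduced space is the surface of revolution of the meridian \<open>w2\<^sup>2 = F(z)\<close>. An equilibrium is a
  point of the meridian where the line of constant energy is tangent to it (\<open>tangency\<close>), or the
  conical point. Each such point lifts to a uniformly rotating solution in \<open>(x, \<pi>)\<close>
  (\<open>equilibria_iff\<close>). The key estimate is \<open>profile_below_tangent\<close>: a line \<open>L\<close> tangent to the
  meridian at a point off the axis, of height \<open>z0\<close>, satisfies \<open>F(z) - L(z)\<^sup>2 = 8 (z - z0)\<^sup>2 (z - r)\<close>, and the third root \<open>r\<close> lies
  beyond the end of the interval of admissible \<open>z\<close>. Hence the tangent plane meets the reduced space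
  in the point of tangency only. This gives stability, because the energy separates the equilibrium
  from the rest of a compact space (\<open>lyapunov_stableI\<close>), and it gives uniqueness, because each of the
  two arcs of the meridian lies on one side of its tangent (\<open>tangency_unique\<close>). Tangencies exist by
  the intermediate value theorem.

  If \<open>j2 = - j1\<close>, then \<open>F(z) = 8 (z + j1) (z - j1)\<^sup>2\<close>, and the two arcs reach the conical point with
  slopes \<open>\<plusminus> 4 \<surd>j1\<close>. If \<open>\<lambda>\<^sup>2 \<ge> 16 j1\<close>, the energy plane through the apex meets the reduced space
  nowhere else, so the apex is stable, and one of the two arcs loses its tangency. If \<open>\<lambda>\<^sup>2 < 16 j1\<close>,
  this plane cuts out a loop. With \<open>b\<^sup>2 = 16 j1 - \<lambda>\<^sup>2\<close> and \<open>v = j1 - z\<close>, the slope \<open>y = w1 / v\<close>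
  parametrizes the loop rationally by \<open>y\<^sup>2 = b\<^sup>2 - 8 v\<close> and satisfies \<open>y' = - \<kappa>/4 (b\<^sup>2 - y\<^sup>2)\<close>. Thus
  \<open>y\<close> is a hyperbolic tangent up to a shift of time, which identifies every homoclinic trajectory
  (\<open>apex_energy_trajectory\<close>), and the corresponding lift to \<open>(x, \<pi>)\<close> is elementary
  (\<open>homoclinic_curve_trajectory\<close>).\<close>

section \<open>The reduced equations of motion\<close>

lemma has_vector_derivative_vec_iff:
  fixes f :: "real \<Rightarrow> real^'n"
  shows "(f has_vector_derivative v) (at t within S) \<longleftrightarrow>
    (\<forall>i. ((\<lambda>t. f t $ i) has_vector_derivative v $ i) (at t within S))"
  unfolding has_vector_derivative_def has_derivative_componentwise_within[of f]
  by (simp add: Basis_vec_def inner_axis)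

lemma has_vector_derivative_pair_iff:
  "(u has_vector_derivative (v, w)) (at x within S) \<longleftrightarrow>
   ((\<lambda>t. fst (u t)) has_vector_derivative v) (at x within S) \<and> ((\<lambda>t. snd (u t)) has_vector_derivative w) (at x within S)"
proof
  assume u: "(u has_vector_derivative (v, w)) (at x within S)"
  show "((\<lambda>t. fst (u t)) has_vector_derivative v) (at x within S) \<and> ((\<lambda>t. snd (u t)) has_vector_derivative w) (at x within S)"
    using bounded_linear.has_vector_derivative[OF bounded_linear_fst u]
      bounded_linear.has_vector_derivative[OF bounded_linear_snd u] by simp
next
  assume "((\<lambda>t. fst (u t)) has_vector_derivative v) (at x within S) \<and> ((\<lambda>t. snd (u t)) has_vector_derivative w) (at x within S)"
  then show "(u has_vector_derivative (v, w)) (at x within S)"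
    using has_vector_derivative_Pair[of "\<lambda>t. fst (u t)" v x S "\<lambda>t. snd (u t)" w] by simp
qed

text \<open>In the equation for \<open>\<pi>\<close> the common moment of inertia \<open>I\<close> cancels, as \<open>\<pi> \<times> I\<pi> = 0\<close>.\<close>

lemma is_solution_drift_iff:
  "is_solution (SO3_reduced (drift_hamiltonian I I \<kappa> a)) u \<longleftrightarrow>
    (\<forall>t. ((\<lambda>t. fst (u t) $ 1) has_real_derivative \<kappa> * snd (u t) $ 2) (at t)
       \<and> ((\<lambda>t. fst (u t) $ 2) has_real_derivative - \<kappa> * snd (u t) $ 1) (at t)
       \<and> ((\<lambda>t. snd (u t) $ 1) has_real_derivative
            a * snd (u t) $ 2 - \<kappa> * snd (u t) $ 3 * fst (u t) $ 2) (at t)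
       \<and> ((\<lambda>t. snd (u t) $ 2) has_real_derivative
            \<kappa> * snd (u t) $ 3 * fst (u t) $ 1 - a * snd (u t) $ 1) (at t)
       \<and> ((\<lambda>t. snd (u t) $ 3) has_real_derivative
            \<kappa> * (snd (u t) $ 1 * fst (u t) $ 2 - snd (u t) $ 2 * fst (u t) $ 1)) (at t))"
proof -
  have field: "hamiltonian_field (SO3_reduced (drift_hamiltonian I I \<kappa> a)) u =
    (vector [\<kappa> * snd u $ 2, - \<kappa> * snd u $ 1],
     vector [a * snd u $ 2 - \<kappa> * snd u $ 3 * fst u $ 2,
       \<kappa> * snd u $ 3 * fst u $ 1 - a * snd u $ 1,
       \<kappa> * (snd u $ 1 * fst u $ 2 - snd u $ 2 * fst u $ 1)])" for u
    using hamiltonian_field_drift[of I I \<kappa> a "fst u" "snd u"]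
    by (simp add: vec_eq_iff forall_3 cross3_simps)
  show ?thesis
    unfolding is_solution_def field has_vector_derivative_pair_iff has_vector_derivative_vec_iff
      has_real_derivative_iff_has_vector_derivative forall_2 forall_3
    by simp
qed

definition profile :: "real \<Rightarrow> real \<Rightarrow> real \<Rightarrow> real" where
  "profile j1 j2 z = 8 * (z\<^sup>2 - j1\<^sup>2) * (z + j2)"

text \<open>The derivative of \<open>profile j1 j2\<close>.\<close>

definition profile_slope :: "real \<Rightarrow> real \<Rightarrow> real \<Rightarrow> real" where
  "profile_slope j1 j2 z = 8 * (3 * z\<^sup>2 + 2 * j2 * z - j1\<^sup>2)"

text \<open>The derivatives of the invariants along a solution are themselves functions of the invariants once
  \<open>|\<pi>|\<close> and \<open>|x|\<close> are expressed through \<open>j1\<close>, \<open>j2\<close> and \<open>\<pi>\<^sub>3\<close>.\<close>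

lemma reduced_trajectory_equations:
  assumes c: "reduced_trajectory (drift_hamiltonian I I \<kappa> a) j1 j2 c"
  shows "c t \<in> reduced_space j1 j2"
    and "((\<lambda>t. c t $ 1) has_real_derivative
           - (\<kappa> / 4 * profile_slope j1 j2 (c t $ 3) + a * c t $ 2)) (at t)"
    and "((\<lambda>t. c t $ 2) has_real_derivative a * c t $ 1) (at t)"
    and "((\<lambda>t. c t $ 3) has_real_derivative - (\<kappa> / 2) * c t $ 1) (at t)"
proof -
  obtain u where sol: "is_solution (SO3_reduced (drift_hamiltonian I I \<kappa> a)) u"
    and lev: "range u \<subseteq> momentum_level j1 j2" and cu: "c = circle_reduction \<circ> u"
    using c unfolding reduced_trajectory_def by blast
  have ut: "(fst (u t), snd (u t)) \<in> momentum_level j1 j2" for t using lev by auto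
  note ut' = ut[unfolded momentum_level_iff]
  have "j1 \<ge> 0" using ut' by blast
  show "c t \<in> reduced_space j1 j2"
    using circle_reduction_image[OF \<open>j1 \<ge> 0\<close>, of j2] lev cu by fastforce
  define x1 where "x1 = (\<lambda>t. fst (u t) $ 1)"
  define x2 where "x2 = (\<lambda>t. fst (u t) $ 2)"
  define p1 where "p1 = (\<lambda>t. snd (u t) $ 1)"
  define p2 where "p2 = (\<lambda>t. snd (u t) $ 2)"
  define p3 where "p3 = (\<lambda>t. snd (u t) $ 3)"
  note defs = x1_def p1_def x2_def p2_def p3_def
  have d: "(x1 has_real_derivative \<kappa> * p2 t) (at t)"
    "(x2 has_real_derivative - \<kappa> * p1 t) (at t)"
    "(p1 has_real_derivative a * p2 t - \<kappa> * p3 t * x2 t) (at t)"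
    "(p2 has_real_derivative \<kappa> * p3 t * x1 t - a * p1 t) (at t)"
    "(p3 has_real_derivative \<kappa> * (p1 t * x2 t - p2 t * x1 t)) (at t)"
    using sol unfolding is_solution_drift_iff defs by blast+
  have c1: "(\<lambda>t. c t $ 1) = (\<lambda>t. 2 * (x1 t * p2 t - x2 t * p1 t))"
    and c2: "(\<lambda>t. c t $ 2) = (\<lambda>t. 2 * (x1 t * p1 t + x2 t * p2 t))"
    and c3: "(\<lambda>t. c t $ 3) = p3"
    by (auto simp: cu circle_reduction_def defs split_beta fun_eq_iff)
  note c' = c1[THEN fun_cong] c2[THEN fun_cong] c3[THEN fun_cong]
  have P: "(p1 t)\<^sup>2 + (p2 t)\<^sup>2 = j1\<^sup>2 - (p3 t)\<^sup>2" and X: "(x1 t)\<^sup>2 + (x2 t)\<^sup>2 = - 2 * (p3 t + j2)"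
    using ut'[of t] unfolding defs by auto
  show "((\<lambda>t. c t $ 2) has_real_derivative a * c t $ 1) (at t)"
    unfolding c1 c2 c'
    by (rule derivative_eq_intros d refl)+ (simp add: algebra_simps)
  show "((\<lambda>t. c t $ 3) has_real_derivative - (\<kappa> / 2) * c t $ 1) (at t)"
    unfolding c3 c' by (rule DERIV_cong[OF d(5)]) (simp add: algebra_simps)
  have "- (\<kappa> / 4 * profile_slope j1 j2 (p3 t) + a * c t $ 2) =
     2 * \<kappa> * (j1\<^sup>2 - (p3 t)\<^sup>2) + 2 * \<kappa> * p3 t * (- 2 * (p3 t + j2)) - a * c t $ 2"
    unfolding profile_slope_def by (simp add: algebra_simps power2_eq_square)
  also have "\<dots> = 2 * \<kappa> * ((p1 t)\<^sup>2 + (p2 t)\<^sup>2) + 2 * \<kappa> * p3 t * ((x1 t)\<^sup>2 + (x2 t)\<^sup>2) - a * c t $ 2"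
    unfolding P X by simp
  finally have e: "- (\<kappa> / 4 * profile_slope j1 j2 (c t $ 3) + a * c t $ 2) = \<dots>" unfolding c' .
  show "((\<lambda>t. c t $ 1) has_real_derivative
           - (\<kappa> / 4 * profile_slope j1 j2 (c t $ 3) + a * c t $ 2)) (at t)"
    unfolding e unfolding c1 unfolding c'
    by (rule derivative_eq_intros d refl)+ (simp add: algebra_simps power2_eq_square)
qed

lemma reduced_energy_conserved:
  assumes "reduced_trajectory (drift_hamiltonian I I \<kappa> a) j1 j2 c"
  shows "\<kappa> / 2 * c t $ 2 + a * c t $ 3 = \<kappa> / 2 * c 0 $ 2 + a * c 0 $ 3"
proof -
  have "((\<lambda>t. \<kappa> / 2 * c t $ 2 + a * c t $ 3) has_real_derivative 0) (at t)" for t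
    by (rule derivative_eq_intros reduced_trajectory_equations(3,4)[OF assms] refl)+ simp
  then show ?thesis by (rule DERIV_isconst_all[rule_format])
qed

lemma reduced_trajectory_shift:
  assumes "reduced_trajectory (drift_hamiltonian I I \<kappa> a) j1 j2 c"
  shows "reduced_trajectory (drift_hamiltonian I I \<kappa> a) j1 j2 (\<lambda>t. c (t + T))"
proof -
  obtain u where sol: "is_solution (SO3_reduced (drift_hamiltonian I I \<kappa> a)) u"
    and lev: "range u \<subseteq> momentum_level j1 j2" and cu: "c = circle_reduction \<circ> u"
    using assms unfolding reduced_trajectory_def by blast
  have "is_solution (SO3_reduced (drift_hamiltonian I I \<kappa> a)) (\<lambda>t. u (t + T))"
    unfolding is_solution_def
  proof
    fix t
    show "((\<lambda>t. u (t + T)) has_vector_derivative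
      hamiltonian_field (SO3_reduced (drift_hamiltonian I I \<kappa> a)) (u (t + T))) (at t)"
      using vector_diff_chain_at[of "\<lambda>t. t + T" 1 t u, OF _ sol[unfolded is_solution_def, rule_format]]
      by (simp add: o_def has_vector_derivative_add_const)
  qed
  then show ?thesis
    unfolding reduced_trajectory_def cu using lev
    by (intro exI[of _ "\<lambda>t. u (t + T)"]) auto
qed

text \<open>A zero of the reduced vector field has to be lifted to a solution in \<open>(x, \<pi>)\<close>. The lift
  is a relative equilibrium: it starts with \<open>x = (s, 0)\<close> and \<open>\<pi> = (r, 0, z)\<close> and is moved by the
  circle action with a constant angular velocity \<open>w\<close>.\<close>

lemma equilibria_iff:
  assumes "j1 \<ge> 0" "\<kappa> \<noteq> 0"
  shows "m \<in> equilibria (drift_hamiltonian I I \<kappa> a) j1 j2 \<longleftrightarrow>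
    m \<in> reduced_space j1 j2 \<and> m $ 1 = 0 \<and> \<kappa> / 4 * profile_slope j1 j2 (m $ 3) + a * m $ 2 = 0"
    (is "_ \<longleftrightarrow> ?R")
proof
  assume "m \<in> equilibria (drift_hamiltonian I I \<kappa> a) j1 j2"
  then have mem: "m \<in> reduced_space j1 j2" and
    traj: "reduced_trajectory (drift_hamiltonian I I \<kappa> a) j1 j2 (\<lambda>t. m)"
    by (auto simp: equilibria_def)
  from DERIV_unique[OF reduced_trajectory_equations(2)[OF traj] DERIV_const]
    DERIV_unique[OF reduced_trajectory_equations(4)[OF traj] DERIV_const] mem assms
  show ?R by simp
next
  assume R: ?R
  define z where "z = m $ 3"
  have mem: "(m $ 2)\<^sup>2 = 8 * (z\<^sup>2 - j1\<^sup>2) * (z + j2)" "- j1 \<le> z" "z \<le> j1" "z \<le> - j2"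
    using R by (auto simp: reduced_space_def z_def)
  have crit: "\<kappa> * (2 * (3 * z\<^sup>2 + 2 * j2 * z - j1\<^sup>2)) + a * m $ 2 = 0"
    using R unfolding profile_slope_def z_def by (simp add: field_simps)
  have "\<exists>r w s. s\<^sup>2 = - 2 * (z + j2) \<and> 2 * s * r = m $ 2 \<and> r\<^sup>2 = j1\<^sup>2 - z\<^sup>2
    \<and> - \<kappa> * r = w * s \<and> \<kappa> * z * s - a * r = w * r"
  proof (cases "z + j2 = 0")
    case True
    then have m2: "m $ 2 = 0" and "z = - j2" using mem by auto
    then have "z\<^sup>2 = j1\<^sup>2" using crit assms by (simp add: power2_eq_square)
    \<comment> \<open>The lift is the rest point with \<open>x = 0\<close> and \<open>\<pi>\<close> on the third axis.\<close>
    then show ?thesis using True m2 by (intro exI[of _ 0]) simp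
  next
    case False
    define s where "s = sqrt (- 2 * (z + j2))"
    define r where "r = m $ 2 / (2 * s)"
    have s: "s\<^sup>2 = - 2 * (z + j2)" "s > 0" using False mem by (auto simp: s_def)
    have sr: "2 * s * r = m $ 2" using s by (simp add: r_def)
    have "4 * s\<^sup>2 * r\<^sup>2 = 4 * s\<^sup>2 * (j1\<^sup>2 - z\<^sup>2)"
      using mem(1) sr s(1) by algebra
    then have r: "r\<^sup>2 = j1\<^sup>2 - z\<^sup>2" using s(2) by simp
    \<comment> \<open>The equation for \<open>x\<close> prescribes the angular velocity \<open>- \<kappa> r / s\<close>; the critical point equation
      says that \<open>\<pi>\<close> rotates with the same velocity.\<close>
    have "s * (\<kappa> * z * s - a * r) + \<kappa> * r\<^sup>2 = 0"
      using crit s(1) r unfolding sr[symmetric] by algebra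
    then have "\<kappa> * z * s - a * r = (- \<kappa> * r / s) * r"
      using s(2) by (simp add: field_simps power2_eq_square)
    then show ?thesis using s sr r by (intro exI[of _ r] exI[of _ "- \<kappa> * r / s"] exI[of _ s]) simp
  qed
  then obtain r w s where h: "s\<^sup>2 = - 2 * (z + j2)" "2 * s * r = m $ 2" "r\<^sup>2 = j1\<^sup>2 - z\<^sup>2"
    "- \<kappa> * r = w * s" "\<kappa> * z * s - a * r = w * r" by blast
  define u :: "real \<Rightarrow> state" where
    "u t = circle_action_state (w * t) (vector [s, 0], vector [r, 0, z])" for t
  have u0: "(vector [s, 0], vector [r, 0, z]) \<in> momentum_level j1 j2"
    unfolding momentum_level_iff using h assms by simp
  have "is_solution (SO3_reduced (drift_hamiltonian I I \<kappa> a)) u"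
    unfolding is_solution_drift_iff u_def circle_action_state_def split rot2_mult rot3_mult fst_conv snd_conv
      vector_2 vector_3
  proof (intro allI conjI)
    fix t
    let ?C = "cos (w * t)" and ?S = "sin (w * t)"
    show "((\<lambda>t. cos (w * t) * s - sin (w * t) * 0) has_real_derivative \<kappa> * (?S * r + ?C * 0)) (at t)"
      by (rule derivative_eq_intros refl)+ (use h(4) in \<open>simp, algebra\<close>)
    show "((\<lambda>t. sin (w * t) * s + cos (w * t) * 0) has_real_derivative - \<kappa> * (?C * r - ?S * 0)) (at t)"
      by (rule derivative_eq_intros refl)+ (use h(4) in \<open>simp, algebra\<close>)
    show "((\<lambda>t. cos (w * t) * r - sin (w * t) * 0) has_real_derivative
        a * (?S * r + ?C * 0) - \<kappa> * z * (?S * s + ?C * 0)) (at t)"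
      by (rule derivative_eq_intros refl)+ (use h(5) in \<open>simp, algebra\<close>)
    show "((\<lambda>t. sin (w * t) * r + cos (w * t) * 0) has_real_derivative
        \<kappa> * z * (?C * s - ?S * 0) - a * (?C * r - ?S * 0)) (at t)"
      by (rule derivative_eq_intros refl)+ (use h(5) in \<open>simp, algebra\<close>)
    show "((\<lambda>t. z) has_real_derivative
        \<kappa> * ((?C * r - ?S * 0) * (?S * s + ?C * 0) - (?S * r + ?C * 0) * (?C * s - ?S * 0))) (at t)"
      by (rule derivative_eq_intros refl)+ simp
  qed
  moreover have "circle_reduction (u t) = m" for t
    unfolding u_def circle_reduction_invariant using R h
    by (simp add: circle_reduction_def vec_eq_iff forall_3 z_def)
  ultimately have "reduced_trajectory (drift_hamiltonian I I \<kappa> a) j1 j2 (\<lambda>t. m)"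
    unfolding reduced_trajectory_def using u0
    by (intro exI[of _ u]) (auto simp: u_def momentum_level_circle_invariant)
  then show "m \<in> equilibria (drift_hamiltonian I I \<kappa> a) j1 j2"
    using R by (simp add: equilibria_def)
qed

section \<open>The meridian cubic and its tangents\<close>

lemma profile_factors:
  "profile j1 j2 z = 8 * (z + j1) * (min j1 (- j2) - z) * (max j1 (- j2) - z)"
  unfolding profile_def by (simp add: min_def max_def algebra_simps power2_eq_square)

lemma profile_nonneg:
  assumes "- j1 \<le> z" "z \<le> min j1 (- j2)"
  shows "0 \<le> profile j1 j2 z"
  unfolding profile_factors using assms by (intro mult_nonneg_nonneg) auto

text \<open>The difference is a cubic in \<open>z\<close> with leading coefficient 8, and tangency makes \<open>z0\<close> a double root;
  the third root is read off from the quadratic coefficient.\<close>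

lemma profile_minus_line:
  assumes "m\<^sup>2 = profile j1 j2 z0" "profile_slope j1 j2 z0 = - 2 * l * m"
  shows "profile j1 j2 z - (m - l * (z - z0))\<^sup>2 = 8 * (z - z0)\<^sup>2 * (z - (l\<^sup>2 / 8 - 2 * z0 - j2))"
  using assms unfolding profile_def profile_slope_def by (simp add: field_simps) algebra

text \<open>At the right end \<open>b\<close> of the meridian the profile vanishes, so the difference of
  \<open>profile_minus_line\<close> is at most 0 there and its third root \<open>r\<close> is at least \<open>b\<close>. Equality would mean
  that the tangent passes through the end of the meridian, which contradicts the signs of the factors
  of the cubic.\<close>

lemma profile_below_tangent:
  assumes j: "j2 < j1"
    and z0: "- j1 \<le> z0" "z0 \<le> min j1 (- j2)"
    and m: "m\<^sup>2 = profile j1 j2 z0" "profile_slope j1 j2 z0 = - 2 * l * m" "m \<noteq> 0"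
    and z: "z \<le> min j1 (- j2)" "z \<noteq> z0"
  shows "profile j1 j2 z < (m - l * (z - z0))\<^sup>2"
proof -
  define b c where "b = min j1 (- j2)" and "c = max j1 (- j2)"
  define r where "r = l\<^sup>2 / 8 - 2 * z0 - j2"
  note eq = profile_minus_line[OF m(1,2), folded r_def]
  have prof: "profile j1 j2 x = 8 * (x + j1) * (b - x) * (c - x)" for x
    using profile_factors b_def c_def by blast
  have bc: "b \<le> c" "j2 = j1 - b - c" by (auto simp: b_def c_def)
  have ne: "z0 \<noteq> - j1" "z0 \<noteq> b" using m(1,3) by (auto simp: prof)
  then have lt: "- j1 < z0" "z0 < b" using z0 b_def by auto
  have "8 * (b - z0)\<^sup>2 * (b - r) = - (m - l * (b - z0))\<^sup>2" using eq[of b] prof[of b] by simp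
  then have "8 * (b - z0)\<^sup>2 * (b - r) \<le> 0" by (metis neg_le_0_iff_le zero_le_power2)
  then have "b \<le> r" using lt by (simp add: mult_le_0_iff)
  moreover have "b \<noteq> r"
  proof
    assume br: "b = r"
    have L: "m = l * (b - z0)" using eq[of b] prof[of b] br by simp
    have "(l\<^sup>2 * (b - z0)) * (b - z0) = (8 * (z0 + j1) * (c - z0)) * (b - z0)"
      using m(1) unfolding L prof by (simp add: power2_eq_square algebra_simps)
    then have 1: "l\<^sup>2 * (b - z0) = 8 * (z0 + j1) * (c - z0)" using lt by simp
    have "l\<^sup>2 = 16 * z0 - 8 * c + 8 * j1" using br bc(2) unfolding r_def by simp
    then have "(z0 + j1) * (b - c) = (b - z0) * (c - z0)"
      using 1 by algebra
    moreover have "(z0 + j1) * (b - c) \<le> 0" using lt bc by (simp add: mult_le_0_iff)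
    moreover have "(b - z0) * (c - z0) > 0" using lt bc by simp
    ultimately show False by linarith
  qed
  ultimately have "z < r" using z b_def by linarith
  then have "8 * (z - z0)\<^sup>2 * (z - r) < 0" using z by (simp add: mult_less_0_iff)
  then show ?thesis using eq[of z] by linarith
qed

text \<open>By \<open>profile_below_tangent\<close> the tangent has no zero above the meridian interval, hence keeps the sign
  of \<open>m\<close>; a comparison of squares then becomes a comparison of values.\<close>

lemma support_line_pos:
  assumes j: "j2 < j1"
    and z0: "- j1 \<le> z0" "z0 \<le> min j1 (- j2)"
    and m: "m\<^sup>2 = profile j1 j2 z0" "profile_slope j1 j2 z0 = - 2 * l * m" "m > 0"
    and y: "x\<^sup>2 + y\<^sup>2 = profile j1 j2 z" "- j1 \<le> z" "z \<le> min j1 (- j2)"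
    and ne: "\<not> (x = 0 \<and> y = m \<and> z = z0)"
  shows "y + l * z < m + l * z0"
proof (cases "z = z0")
  case True
  then have xy: "x\<^sup>2 + y\<^sup>2 = m\<^sup>2" using m y by simp
  then have "y\<^sup>2 \<le> m\<^sup>2" using zero_le_power2[of x] by linarith
  then have "y \<le> m" using m(3) power2_le_imp_le[of y m] by simp
  moreover have "y \<noteq> m" using xy ne True by auto
  ultimately show ?thesis using True by simp
next
  case False
  define L where "L t = m - l * (t - z0)" for t
  have below: "profile j1 j2 t < (L t)\<^sup>2" if "t \<le> min j1 (- j2)" "t \<noteq> z0" for t
    using profile_below_tangent[OF j z0 m(1,2)] m(3) that unfolding L_def by simp
  have nonzero: "L t \<noteq> 0" if t: "- j1 \<le> t" "t \<le> min j1 (- j2)" for t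
  proof (cases "t = z0")
    case False
    have "profile j1 j2 t \<ge> 0" using profile_nonneg t by blast
    then show ?thesis using below[OF t(2) False] by auto
  qed (use m in \<open>simp add: L_def\<close>)
  have "L z > 0"
  proof (rule ccontr)
    assume "\<not> L z > 0"
    then have "L z \<le> 0" by simp
    moreover have "L z0 > 0" using m by (simp add: L_def)
    ultimately have "0 \<in> closed_segment (L z) (L z0)" by (simp add: closed_segment_eq_real_ivl)
    moreover have "continuous_on (closed_segment z z0) L" unfolding L_def by (intro continuous_intros)
    ultimately have "\<exists>t\<in>closed_segment z z0. L t = 0" using IVT'_closed_segment_real by blast
    then show False using nonzero z0 y by (auto simp: closed_segment_eq_real_ivl split: if_splits)
  qed
  moreover have "y\<^sup>2 < (L z)\<^sup>2" using below[OF y(3) False] y(1) zero_le_power2[of x] by linarith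
  ultimately have "y < L z" using power2_less_imp_less[of y "L z"] by simp
  then show ?thesis unfolding L_def by (simp add: algebra_simps)
qed

text \<open>The reflection \<open>w\<^sub>2 \<mapsto> - w\<^sub>2\<close> reduces this to \<open>support_line_pos\<close>.\<close>

lemma support_line_neg:
  assumes j: "j2 < j1"
    and z0: "- j1 \<le> z0" "z0 \<le> min j1 (- j2)"
    and m: "m\<^sup>2 = profile j1 j2 z0" "profile_slope j1 j2 z0 = - 2 * l * m" "m < 0"
    and y: "x\<^sup>2 + y\<^sup>2 = profile j1 j2 z" "- j1 \<le> z" "z \<le> min j1 (- j2)"
    and ne: "\<not> (x = 0 \<and> y = m \<and> z = z0)"
  shows "y + l * z > m + l * z0"
  using support_line_pos[OF j z0, of "- m" "- l" x "- y" z] assms by auto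

text \<open>At each of the three roots the slope is a multiple of the product of the distances to the other
  two roots.\<close>

lemma profile_double_zero:
  assumes "j1 > 0" "j2 < j1" "profile j1 j2 z = 0" "profile_slope j1 j2 z = 0"
  shows "j2 = - j1 \<and> z = j1"
proof -
  have "(z + j1) * (z - j1) * (z + j2) = 0"
    using assms(3) by (simp add: profile_def algebra_simps power2_eq_square)
  then consider "z = - j1" | "z = j1" | "z = - j2" by fastforce
  then show ?thesis
  proof cases
    case 1
    then have "j1 * (j1 - j2) = 0"
      using assms(4) by (simp add: profile_slope_def algebra_simps power2_eq_square)
    then show ?thesis using assms by simp
  next
    case 2
    then have "j1 * (j1 + j2) = 0"
      using assms(4) by (simp add: profile_slope_def algebra_simps power2_eq_square)
    then show ?thesis using assms 2 by simp
  next
    case 3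
    then have "(j1 - j2) * (j1 + j2) = 0"
      using assms(4) by (simp add: profile_slope_def algebra_simps power2_eq_square)
    then show ?thesis using assms 3 by auto
  qed
qed

lemma profile_conical: "profile j (- j) z = 8 * (z + j) * (j - z)\<^sup>2"
  by (simp add: profile_def power2_eq_square algebra_simps)

lemma profile_slope_conical: "profile_slope j (- j) z = - 8 * (j - z) * (3 * z + j)"
  by (simp add: profile_slope_def power2_eq_square algebra_simps)

text \<open>The line through \<open>(m, z)\<close> along which \<open>w\<^sub>2 + l z\<close> is constant touches the meridian
  \<open>w\<^sub>2\<^sup>2 = profile j1 j2 z\<close> at \<open>(m, z)\<close>, or \<open>(m, z)\<close> is a double point of the meridian.\<close>

definition tangency :: "real \<Rightarrow> real \<Rightarrow> real \<Rightarrow> real \<Rightarrow> real \<Rightarrow> bool" where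
  "tangency j1 j2 l m z \<longleftrightarrow> - j1 \<le> z \<and> z \<le> min j1 (- j2)
     \<and> m\<^sup>2 = profile j1 j2 z \<and> profile_slope j1 j2 z = - 2 * l * m"

lemma reduced_space_iff:
  "w \<in> reduced_space j1 j2 \<longleftrightarrow>
    (w $ 1)\<^sup>2 + (w $ 2)\<^sup>2 = profile j1 j2 (w $ 3) \<and> - j1 \<le> w $ 3 \<and> w $ 3 \<le> min j1 (- j2)"
  by (auto simp: reduced_space_def profile_def)

lemma equilibria_iff_tangency:
  assumes "j1 \<ge> 0" "\<kappa> \<noteq> 0"
  shows "w \<in> equilibria (drift_hamiltonian I I \<kappa> a) j1 j2 \<longleftrightarrow>
    w $ 1 = 0 \<and> tangency j1 j2 (2 * a / \<kappa>) (w $ 2) (w $ 3)"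
  unfolding equilibria_iff[OF assms] reduced_space_iff tangency_def
  using assms(2) by (auto simp: field_simps)

lemma tangency_mirror: "tangency j1 j2 (- l) m z \<longleftrightarrow> tangency j1 j2 l (- m) z"
  by (auto simp: tangency_def)

text \<open>On the reduced space \<open>m\<close> is the strict maximum of \<open>w\<^sub>2 + l w\<^sub>3\<close> if \<open>m$2 > 0\<close>, and the strict
  minimum if \<open>m$2 < 0\<close>.\<close>

lemma tangency_separates:
  assumes "j2 < j1" "tangency j1 j2 l (m $ 2) (m $ 3)" "m $ 1 = 0" "m $ 2 \<noteq> 0"
    and "w \<in> reduced_space j1 j2" "w $ 2 + l * w $ 3 = m $ 2 + l * m $ 3"
  shows "w = m"
proof (rule ccontr)
  assume "w \<noteq> m"
  then have ne: "\<not> (w $ 1 = 0 \<and> w $ 2 = m $ 2 \<and> w $ 3 = m $ 3)"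
    using assms(3) by (auto simp: vec_eq_iff forall_3)
  have w: "(w $ 1)\<^sup>2 + (w $ 2)\<^sup>2 = profile j1 j2 (w $ 3)" "- j1 \<le> w $ 3" "w $ 3 \<le> min j1 (- j2)"
    using assms(5) unfolding reduced_space_iff by blast+
  have m: "- j1 \<le> m $ 3" "m $ 3 \<le> min j1 (- j2)" "(m $ 2)\<^sup>2 = profile j1 j2 (m $ 3)"
    "profile_slope j1 j2 (m $ 3) = - 2 * l * m $ 2"
    using assms(2) unfolding tangency_def by blast+
  consider "m $ 2 > 0" | "m $ 2 < 0" using assms(4) by linarith
  then show False
    using support_line_pos[OF assms(1) m _ w ne] support_line_neg[OF assms(1) m _ w ne] assms(6)
    by cases linarith+
qed

text \<open>Two equilibria on the same arc of the meridian would lie strictly on the same side of each other's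
  supporting line.\<close>

lemma tangency_unique:
  assumes "j2 < j1" "tangency j1 j2 l m z" "tangency j1 j2 l m' z'" "m * m' > 0"
  shows "m = m' \<and> z = z'"
proof (rule ccontr)
  assume ne: "\<not> (m = m' \<and> z = z')"
  have m: "- j1 \<le> z" "z \<le> min j1 (- j2)" "m\<^sup>2 = profile j1 j2 z" "profile_slope j1 j2 z = - 2 * l * m"
    and m': "- j1 \<le> z'" "z' \<le> min j1 (- j2)" "m'\<^sup>2 = profile j1 j2 z'"
      "profile_slope j1 j2 z' = - 2 * l * m'"
    using assms(2,3) unfolding tangency_def by blast+
  have w: "0\<^sup>2 + m\<^sup>2 = profile j1 j2 z" and w': "0\<^sup>2 + m'\<^sup>2 = profile j1 j2 z'"
    using m(3) m'(3) by simp_all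
  have ne1: "\<not> ((0::real) = 0 \<and> m = m' \<and> z = z')" and ne2: "\<not> ((0::real) = 0 \<and> m' = m \<and> z' = z)"
    using ne by auto
  consider "m > 0" "m' > 0" | "m < 0" "m' < 0" using assms(4) by (auto simp: zero_less_mult_iff)
  then show False
  proof cases
    case 1
    show ?thesis
      using support_line_pos[OF assms(1) m 1(1) w' m'(1,2) ne2]
        support_line_pos[OF assms(1) m' 1(2) w m(1,2) ne1] by linarith
  next
    case 2
    show ?thesis
      using support_line_neg[OF assms(1) m 2(1) w' m'(1,2) ne2]
        support_line_neg[OF assms(1) m' 2(2) w m(1,2) ne1] by linarith
  qed
qed

text \<open>On the arc \<open>w\<^sub>2 = \<surd>F\<close> tangency reads \<open>F' + 2 l \<surd>F = 0\<close>. At the two ends \<open>F\<close> vanishes, and \<open>F'\<close> has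
  opposite signs there.\<close>

lemma tangency_exists_smooth:
  assumes j: "j1 > 0" "j2 < j1" "j2 \<noteq> - j1"
  shows "\<exists>m z. m > 0 \<and> tangency j1 j2 l m z"
proof -
  define b where "b = min j1 (- j2)"
  define g where "g z = profile_slope j1 j2 z + 2 * l * sqrt (profile j1 j2 z)" for z
  have prof: "profile j1 j2 (- j1) = 0" "profile j1 j2 b = 0" by (simp_all add: profile_factors b_def)
  have "profile_slope j1 j2 (- j1) = 16 * j1 * (j1 - j2)"
    by (simp add: profile_slope_def power2_eq_square algebra_simps)
  then have "g (- j1) \<ge> 0" using j by (simp add: g_def prof)
  moreover have "g b \<le> 0"
  proof (cases "j1 < - j2")
    case True
    then have "profile_slope j1 j2 b = 16 * j1 * (j1 + j2)"
      by (simp add: b_def profile_slope_def power2_eq_square algebra_simps)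
    then show ?thesis using j True by (simp add: g_def prof mult_le_0_iff)
  next
    case False
    then have "profile_slope j1 j2 b = - 8 * (j1 - j2) * (j1 + j2)"
      by (simp add: b_def profile_slope_def power2_eq_square algebra_simps)
    then show ?thesis using j False by (simp add: g_def prof mult_le_0_iff)
  qed
  moreover have "continuous_on {- j1..b} g"
    unfolding g_def profile_slope_def profile_def by (intro continuous_intros)
  moreover have "- j1 \<le> b" using j by (simp add: b_def)
  ultimately obtain z where z: "- j1 \<le> z" "z \<le> b" "g z = 0"
    using IVT2'[of g b 0 "- j1"] by blast
  have nonneg: "profile j1 j2 z \<ge> 0" using profile_nonneg z unfolding b_def by blast
  have "profile j1 j2 z \<noteq> 0"
    using profile_double_zero[OF j(1,2), of z] j(3) z(3) by (auto simp: g_def)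
  with nonneg z show ?thesis
    by (intro exI[of _ "sqrt (profile j1 j2 z)"] exI[of _ z])
      (simp add: g_def b_def tangency_def)
qed

text \<open>Here \<open>F'\<close> vanishes at the apex as well. Dividing the tangency equation by \<open>j - z\<close> leaves a
  function whose sign at the apex is decided by comparing \<open>l\<close> with the slope \<open>4 \<surd>j\<close> of the cone.\<close>

lemma tangency_exists_conical:
  assumes j: "j > 0" and l: "l < 4 * sqrt j"
  shows "\<exists>m z. m > 0 \<and> tangency j (- j) l m z"
proof -
  define g where "g z = - 8 * (3 * z + j) + 2 * l * sqrt (8 * (z + j))" for z
  have g0: "g (- j) > 0" using j by (simp add: g_def)
  have "sqrt (16 * j) = 4 * sqrt j" by (simp add: real_sqrt_mult)
  then have "g j = - 8 * sqrt j * (4 * sqrt j - l)"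
    using j by (simp add: g_def algebra_simps)
  then have gj: "g j < 0" using j l by simp
  have "continuous_on {- j..j} g" unfolding g_def by (intro continuous_intros)
  then obtain z where z: "- j \<le> z" "z \<le> j" "g z = 0"
    using IVT2'[of g j 0 "- j"] g0 gj j by auto
  then have lt: "- j < z" "z < j" using g0 gj by (auto simp: less_le)
  have "sqrt (8 * (z + j)) * (j - z) > 0" using lt by simp
  moreover have "(sqrt (8 * (z + j)) * (j - z))\<^sup>2 = profile j (- j) z"
    using lt by (simp add: profile_conical power_mult_distrib)
  moreover have "profile_slope j (- j) z = - 2 * l * (sqrt (8 * (z + j)) * (j - z))"
    using z(3) unfolding profile_slope_conical g_def by algebra
  moreover have "- j \<le> z" "z \<le> min j (- (- j))" using lt by simp_all
  ultimately show ?thesis unfolding tangency_def by blast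
qed

text \<open>The apex would lie strictly below the supporting line of such a tangency; comparing squares at
  height \<open>z\<close> then bounds \<open>l\<close> strictly by the slope \<open>4 \<surd>j\<close> of the cone.\<close>

lemma no_tangency_conical:
  assumes j: "j > 0" and l: "l > 0" "l\<^sup>2 \<ge> 16 * j" and m: "m > 0"
  shows "\<not> tangency j (- j) l m z"
proof
  assume t: "tangency j (- j) l m z"
  then have z: "- j \<le> z" "z \<le> j" by (auto simp: tangency_def)
  have "z \<noteq> j" using t m by (auto simp: tangency_def profile_conical)
  then have "0 + l * j < m + l * z"
    using t m j unfolding tangency_def
    by (intro support_line_pos[of "- j" j z m l 0 0 j]) (auto simp: profile_conical)
  then have "(l * (j - z))\<^sup>2 < m\<^sup>2"
    using l z by (intro power_strict_mono) (auto simp: algebra_simps)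
  also have "m\<^sup>2 = 8 * (z + j) * (j - z)\<^sup>2" using t by (simp add: tangency_def profile_conical)
  finally have "l\<^sup>2 < 8 * (z + j)"
    using z \<open>z \<noteq> j\<close> by (simp add: power_mult_distrib)
  moreover have "8 * (z + j) \<le> 16 * j" using z by simp
  ultimately show False using l(2) by linarith
qed

lemma tangency_zero_iff:
  assumes "j1 > 0" "j2 < j1"
  shows "tangency j1 j2 l 0 z \<longleftrightarrow> j2 = - j1 \<and> z = j1"
proof
  assume "tangency j1 j2 l 0 z"
  then show "j2 = - j1 \<and> z = j1"
    by (intro profile_double_zero assms) (auto simp: tangency_def)
qed (use assms in \<open>auto simp: tangency_def profile_conical profile_slope_conical\<close>)

lemma card_regular_tangencies:
  assumes "j2 < j1" "tangency j1 j2 l m z" "m > 0" "tangency j1 j2 l m' z'" "m' < 0"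
  shows "card {w :: real^3. w $ 1 = 0 \<and> w $ 2 \<noteq> 0 \<and> tangency j1 j2 l (w $ 2) (w $ 3)} = 2"
proof -
  let ?p = "vector [0, m, z] :: real^3" and ?q = "vector [0, m', z'] :: real^3"
  have "w = ?p \<or> w = ?q" if "w $ 1 = 0" "w $ 2 \<noteq> 0" "tangency j1 j2 l (w $ 2) (w $ 3)" for w :: "real^3"
  proof (cases "w $ 2 > 0")
    case True
    then have "w $ 2 = m \<and> w $ 3 = z"
      using assms by (intro tangency_unique[OF _ that(3)]) auto
    then show ?thesis using that by (auto intro!: vec3_eqI)
  next
    case False
    then have "w $ 2 = m' \<and> w $ 3 = z'"
      using assms that(2) by (intro tangency_unique[OF _ that(3)]) (auto simp: zero_less_mult_iff)
    then show ?thesis using that by (auto intro!: vec3_eqI)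
  qed
  then have "{w :: real^3. w $ 1 = 0 \<and> w $ 2 \<noteq> 0 \<and> tangency j1 j2 l (w $ 2) (w $ 3)} = {?p, ?q}"
    using assms by auto
  moreover have "?p \<noteq> ?q" using assms by (auto simp: vec_eq_iff forall_3)
  ultimately show ?thesis by simp
qed

text \<open>The sign of \<open>l\<close> decides which of the two arcs of the meridian keeps its tangency.\<close>

lemma card_regular_tangencies_apex:
  assumes j: "j > 0" and l: "l\<^sup>2 \<ge> 16 * j"
  shows "card {w :: real^3. w $ 1 = 0 \<and> w $ 2 \<noteq> 0 \<and> tangency j (- j) l (w $ 2) (w $ 3)} = 1"
proof -
  have "\<exists>m z. m \<noteq> 0 \<and> tangency j (- j) l m z \<and> (\<forall>m' z'. m' * m < 0 \<longrightarrow> \<not> tangency j (- j) l m' z')"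
  proof -
    consider "l > 0" | "l < 0" using l j by (cases l "0 :: real" rule: linorder_cases) auto
    then show ?thesis
    proof cases
      case 1
      have "- l < 4 * sqrt j" using 1 real_sqrt_gt_zero[OF j] by linarith
      then obtain m z where "m > 0" "tangency j (- j) (- l) m z"
        using tangency_exists_conical[OF j] by blast
      then have "- m \<noteq> 0 \<and> tangency j (- j) l (- m) z
          \<and> (\<forall>m' z'. m' * (- m) < 0 \<longrightarrow> \<not> tangency j (- j) l m' z')"
        using no_tangency_conical[OF j 1 l] by (auto simp: tangency_mirror zero_less_mult_iff)
      then show ?thesis by blast
    next
      case 2
      then have l': "- l > 0" "(- l)\<^sup>2 \<ge> 16 * j" using l by auto
      have "l < 4 * sqrt j" using 2 real_sqrt_gt_zero[OF j] by linarith
      then obtain m z where "m > 0" "tangency j (- j) l m z"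
        using tangency_exists_conical[OF j] by blast
      moreover have "\<not> tangency j (- j) l m' z'" if "m' < 0" for m' z'
        using no_tangency_conical[OF j l', of "- m'" z'] that by (simp add: tangency_mirror)
      ultimately have "m \<noteq> 0 \<and> tangency j (- j) l m z
          \<and> (\<forall>m' z'. m' * m < 0 \<longrightarrow> \<not> tangency j (- j) l m' z')"
        by (auto simp: mult_less_0_iff)
      then show ?thesis by blast
    qed
  qed
  then obtain m z where m: "m \<noteq> 0" "tangency j (- j) l m z"
    and other: "\<And>m' z'. m' * m < 0 \<Longrightarrow> \<not> tangency j (- j) l m' z'" by blast
  have "w = vector [0, m, z]" if "w $ 1 = 0" "w $ 2 \<noteq> 0" "tangency j (- j) l (w $ 2) (w $ 3)" for w :: "real^3"
  proof -
    have "w $ 2 * m > 0" using other[of "w $ 2" "w $ 3"] that m(1) by (meson linorder_neqE_linordered_idom mult_eq_0_iff)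
    then have "w $ 2 = m \<and> w $ 3 = z" using j by (intro tangency_unique[OF _ that(3) m(2)]) auto
    then show ?thesis using that(1) by (intro vec3_eqI) auto
  qed
  then have "{w :: real^3. w $ 1 = 0 \<and> w $ 2 \<noteq> 0 \<and> tangency j (- j) l (w $ 2) (w $ 3)} = {vector [0, m, z]}"
    using m by auto
  then show ?thesis by simp
qed

section \<open>Geometry of the reduced spaces\<close>

text \<open>The polynomials in the coordinates and in the functions of \<open>B\<close>. Since \<open>smooth_on\<close> is coinductive,
  smoothness of a function follows from membership in a class that is closed under directional
  derivatives; these polynomials are such a class once the derivatives of the generators are again
  polynomials.\<close>

inductive polynomial_over :: "(real^3 \<Rightarrow> real) set \<Rightarrow> (real^3 \<Rightarrow> real) \<Rightarrow> bool" for B where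
  generator: "f \<in> B \<Longrightarrow> polynomial_over B f"
| const: "polynomial_over B (\<lambda>x. r)"
| coordinate: "polynomial_over B (\<lambda>x. x $ i)"
| add: "polynomial_over B f \<Longrightarrow> polynomial_over B g \<Longrightarrow> polynomial_over B (\<lambda>x. f x + g x)"
| mult: "polynomial_over B f \<Longrightarrow> polynomial_over B g \<Longrightarrow> polynomial_over B (\<lambda>x. f x * g x)"

lemma polynomial_over_diff:
  assumes "polynomial_over B f" "polynomial_over B g"
  shows "polynomial_over B (\<lambda>x. f x - g x)"
  using polynomial_over.add[OF assms(1) polynomial_over.mult[OF polynomial_over.const[of B "- 1"] assms(2)]]
  by simp

lemma polynomial_over_power:
  assumes "polynomial_over B f"
  shows "polynomial_over B (\<lambda>x. f x ^ n)"
  by (induction n) (auto intro: polynomial_over.intros assms)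

lemmas polynomial_over_intros =
  polynomial_over.const polynomial_over.coordinate polynomial_over.add polynomial_over.mult
  polynomial_over_diff polynomial_over_power

definition closed_under_derivatives :: "(real^3) set \<Rightarrow> (real^3 \<Rightarrow> real) set \<Rightarrow> bool" where
  "closed_under_derivatives U B \<longleftrightarrow> (\<forall>f\<in>B. \<exists>f'. (\<forall>x\<in>U. (f has_derivative f' x) (at x))
     \<and> (\<forall>v. polynomial_over B (\<lambda>x. f' x v)))"

lemma polynomial_over_derivative:
  assumes "closed_under_derivatives U B" "polynomial_over B f"
  shows "\<exists>f'. (\<forall>x\<in>U. (f has_derivative f' x) (at x)) \<and> (\<forall>v. polynomial_over B (\<lambda>x. f' x v))"
  using assms(2)
proof induction
  case (generator f)
  then show ?case using assms(1) unfolding closed_under_derivatives_def by blast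
next
  case (const r)
  show ?case by (intro exI[of _ "\<lambda>x v. 0"]) (auto intro: polynomial_over_intros)
next
  case (coordinate i)
  show ?case
    by (intro exI[of _ "\<lambda>x v. v $ i"])
      (auto intro: polynomial_over_intros bounded_linear_imp_has_derivative bounded_linear_vec_nth)
next
  case (add f g)
  then obtain f' g' where
    "\<forall>x\<in>U. (f has_derivative f' x) (at x)" "\<forall>v. polynomial_over B (\<lambda>x. f' x v)"
    "\<forall>x\<in>U. (g has_derivative g' x) (at x)" "\<forall>v. polynomial_over B (\<lambda>x. g' x v)"
    by blast
  then show ?case
    by (intro exI[of _ "\<lambda>x v. f' x v + g' x v"]) (auto intro!: polynomial_over_intros has_derivative_add)
next
  case (mult f g)
  then obtain f' g' where
    "\<forall>x\<in>U. (f has_derivative f' x) (at x)" "\<forall>v. polynomial_over B (\<lambda>x. f' x v)"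
    "\<forall>x\<in>U. (g has_derivative g' x) (at x)" "\<forall>v. polynomial_over B (\<lambda>x. g' x v)"
    by blast
  then show ?case
    using mult.hyps
    by (intro exI[of _ "\<lambda>x v. f x * g' x v + f' x v * g x"])
      (auto intro!: polynomial_over_intros has_derivative_mult)
qed

lemma smooth_on_polynomial_over:
  assumes "closed_under_derivatives U B" "polynomial_over B f"
  shows "smooth_on U f"
  using assms(2)
proof (coinduction arbitrary: f)
  case smooth_on
  then show ?case using polynomial_over_derivative[OF assms(1)] by blast
qed

lemma smooth_on_polynomial_over_vec:
  fixes f :: "real^3 \<Rightarrow> real^'n"
  assumes "closed_under_derivatives U B" "\<And>i. polynomial_over B (\<lambda>x. f x $ i)"
  shows "smooth_on U f"
  using assms(2)
proof (coinduction arbitrary: f)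
  case (smooth_on f)
  then have "\<forall>i. \<exists>f'. (\<forall>x\<in>U. ((\<lambda>x. f x $ i) has_derivative f' x) (at x))
      \<and> (\<forall>v. polynomial_over B (\<lambda>x. f' x v))"
    using polynomial_over_derivative[OF assms(1)] by blast
  then obtain f' where f': "\<And>i x. x \<in> U \<Longrightarrow> ((\<lambda>x. f x $ i) has_derivative f' i x) (at x)"
    "\<And>i v. polynomial_over B (\<lambda>x. f' i x v)" by metis
  have "(f has_derivative (\<lambda>v. \<chi> i. f' i x v)) (at x)" if "x \<in> U" for x
    unfolding has_derivative_componentwise_within[of f]
    using f'(1)[OF that] by (auto simp: Basis_vec_def inner_axis)
  then show ?case using f'(2) by (intro exI[of _ f] exI[of _ "\<lambda>x v. \<chi> i. f' i x v"]) auto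
qed

lemma has_derivative_profile:
  "((\<lambda>w::real^3. (w $ 1)\<^sup>2 + (w $ 2)\<^sup>2 - profile j1 j2 (w $ 3)) has_derivative
    (\<lambda>v. 2 * p $ 1 * v $ 1 + 2 * p $ 2 * v $ 2 - profile_slope j1 j2 (p $ 3) * v $ 3)) (at p)"
proof -
  have nth: "((\<lambda>w::real^3. w $ i) has_derivative (\<lambda>v. v $ i)) (at p)" for i
    by (intro bounded_linear_imp_has_derivative bounded_linear_vec_nth)
  show ?thesis
    unfolding profile_def
    by (rule derivative_eq_intros nth refl)+
      (simp add: fun_eq_iff profile_slope_def algebra_simps power2_eq_square)
qed

text \<open>The inequalities in the reduced space follow from its equation on the half-space below the third
  root of the profile, and the equation is regular except at a double root.\<close>

lemma smooth_surface_at_reduced_space: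
  assumes j: "j1 > 0" "j2 < j1" and p: "p \<in> reduced_space j1 j2"
    and regular: "\<not> (j2 = - j1 \<and> p $ 3 = j1)"
  shows "smooth_surface_at (reduced_space j1 j2) p"
proof -
  define b c where "b = min j1 (- j2)" and "c = max j1 (- j2)"
  have bc: "b \<le> c" "- j1 < b" using j by (auto simp: b_def c_def)
  have prof: "profile j1 j2 x = 8 * (x + j1) * (b - x) * (c - x)" for x
    using profile_factors b_def c_def by blast
  let ?U = "{w :: real^3. w $ 3 < c}"
  let ?f = "\<lambda>w::real^3. (w $ 1)\<^sup>2 + (w $ 2)\<^sup>2 - profile j1 j2 (w $ 3)"
  note p' = p[unfolded reduced_space_iff, folded b_def]
  have "open ?U" by (intro open_Collect_less continuous_intros)
  moreover have "p \<in> ?U" using p' regular j by (auto simp: b_def c_def)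
  moreover have "smooth_on ?U ?f"
    unfolding profile_def
    by (rule smooth_on_polynomial_over[of _ "{}"])
      (simp_all add: closed_under_derivatives_def polynomial_over_intros)
  moreover have "reduced_space j1 j2 \<inter> ?U = {w \<in> ?U. ?f w = 0}"
  proof -
    have "- j1 \<le> w $ 3 \<and> w $ 3 \<le> b" if w: "w $ 3 < c" "?f w = 0" for w
    proof -
      have "profile j1 j2 (w $ 3) \<ge> 0" using w(2) sum_power2_ge_zero[of "w $ 1" "w $ 2"] by linarith
      then have "0 \<le> (w $ 3 + j1) * (b - w $ 3)"
        using w(1) unfolding prof by (auto simp: zero_le_mult_iff)
      then show ?thesis using bc by (auto simp: zero_le_mult_iff)
    qed
    then show ?thesis by (auto simp: reduced_space_iff simp flip: b_def)
  qed
  moreover have "frechet_derivative ?f (at p) \<noteq> (\<lambda>v. 0)"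
  proof
    assume "frechet_derivative ?f (at p) = (\<lambda>v. 0)"
    then have D: "2 * p $ 1 * v $ 1 + 2 * p $ 2 * v $ 2 - profile_slope j1 j2 (p $ 3) * v $ 3 = 0"
      for v :: "real^3"
      unfolding frechet_derivative_at[OF has_derivative_profile, symmetric] by (rule fun_cong)
    have "p $ 1 = 0" "p $ 2 = 0" "profile_slope j1 j2 (p $ 3) = 0"
      using D[of "axis 1 1"] D[of "axis 2 1"] D[of "axis 3 1"] by (auto simp: axis_def)
    then show False
      using profile_double_zero[OF j, of "p $ 3"] p' regular by simp
  qed
  ultimately show ?thesis unfolding smooth_surface_at_def by blast
qed

text \<open>The unit sphere is itself the surface of revolution of the quadratic factor of the profile with roots
  \<open>- j1\<close> and \<open>b = min j1 (- j2)\<close>. Multiplying its horizontal radius by the root of the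
  remaining linear factor gives a continuous map onto the reduced space. That factor can vanish only
  at the north pole, so the map is injective also in the conical case.\<close>

lemma topological_sphere_reduced_space:
  assumes j: "j1 > 0" "j2 < j1"
  shows "topological_sphere (reduced_space j1 j2)"
proof -
  define b c where "b = min j1 (- j2)" and "c = max j1 (- j2)"
  have bc: "b \<le> c" "- j1 < b" using j by (auto simp: b_def c_def)
  have prof: "profile j1 j2 x = 8 * (x + j1) * (b - x) * (c - x)" for x
    using profile_factors b_def c_def by blast
  \<comment> \<open>\<open>Z\<close> maps the heights \<open>[-1, 1]\<close> of the sphere affinely onto \<open>[- j1, b]\<close>.\<close>
  define h where "h = (b + j1) / 2"
  define Z where "Z y = h * (1 + y $ 3) - j1" for y :: "real^3"
  define k where "k z = h * sqrt (8 * (c - z))" for z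
  define \<Phi> :: "real^3 \<Rightarrow> real^3" where "\<Phi> y = vector [y $ 1 * k (Z y), y $ 2 * k (Z y), Z y]" for y
  have h: "h > 0" "b = 2 * h - j1" using bc by (simp_all add: h_def field_simps)
  have sphere: "y \<in> sphere 0 1 \<longleftrightarrow> (y $ 1)\<^sup>2 + (y $ 2)\<^sup>2 = 1 - (y $ 3)\<^sup>2" for y :: "real^3"
    by (simp add: norm_vec_def L2_set_def sum_3) (auto simp: algebra_simps)
  have y3: "\<bar>y $ 3\<bar> \<le> 1" if "y \<in> sphere 0 1" for y :: "real^3"
    using that sum_power2_ge_zero[of "y $ 1" "y $ 2"] unfolding sphere abs_square_le_1[symmetric] by linarith
  have Z: "- j1 \<le> Z y" "Z y \<le> b" if "y \<in> sphere 0 1" for y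
    using y3[OF that] h mult_left_mono[of "1 + y $ 3" 2 h] by (auto simp: Z_def)
  have k: "(k z)\<^sup>2 = 8 * h\<^sup>2 * (c - z)" if "z \<le> b" for z
    using that bc by (simp add: k_def power_mult_distrib)
  have prof_Z: "profile j1 j2 (Z y) = 8 * h\<^sup>2 * (c - Z y) * (1 - (y $ 3)\<^sup>2)" for y
    unfolding prof h(2) unfolding Z_def by (simp add: power2_eq_square algebra_simps)
  have "\<Phi> ` sphere 0 1 = reduced_space j1 j2"
  proof (intro equalityI subsetI)
    fix w assume "w \<in> \<Phi> ` sphere 0 1"
    then obtain y where y: "y \<in> sphere 0 1" and w: "w = \<Phi> y" by blast
    have "(w $ 1)\<^sup>2 + (w $ 2)\<^sup>2 = ((y $ 1)\<^sup>2 + (y $ 2)\<^sup>2) * (k (Z y))\<^sup>2"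
      by (simp add: w \<Phi>_def power_mult_distrib algebra_simps)
    also have "\<dots> = profile j1 j2 (w $ 3)"
      using y unfolding sphere k[OF Z(2)[OF y]] by (simp add: w \<Phi>_def prof_Z)
    finally show "w \<in> reduced_space j1 j2"
      using Z[OF y] by (simp add: reduced_space_iff w \<Phi>_def b_def)
  next
    fix w assume w: "w \<in> reduced_space j1 j2"
    note w' = w[unfolded reduced_space_iff, folded b_def]
    define y3 where "y3 = (w $ 3 + j1) / h - 1"
    have z: "w $ 3 = h * (1 + y3) - j1" using h by (simp add: y3_def field_simps)
    show "w \<in> \<Phi> ` sphere 0 1"
    proof (cases "w $ 3 = c")
      case True
      then have "w $ 3 = b" using w' bc by simp
      then have "y3 = 1" "w $ 1 = 0" "w $ 2 = 0"
        using w' h by (auto simp: y3_def prof sum_power2_eq_zero_iff)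
      then have "w = \<Phi> (vector [0, 0, 1])" using z
        by (simp add: \<Phi>_def Z_def vec_eq_iff forall_3)
      moreover have "vector [0, 0, 1] \<in> sphere (0::real^3) 1" unfolding sphere by simp
      ultimately show ?thesis by blast
    next
      case False
      then have "w $ 3 < c" using w' bc by simp
      then have k0: "k (w $ 3) > 0" using h by (simp add: k_def)
      define y :: "real^3" where "y = vector [w $ 1 / k (w $ 3), w $ 2 / k (w $ 3), y3]"
      have Zy: "Z y = w $ 3" by (simp add: Z_def y_def z)
      have "((y $ 1)\<^sup>2 + (y $ 2)\<^sup>2) * (k (w $ 3))\<^sup>2 = (w $ 1)\<^sup>2 + (w $ 2)\<^sup>2"
        using k0 by (simp add: y_def power_divide distrib_right)
      also have "\<dots> = profile j1 j2 (Z y)" using w' unfolding Zy by blast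
      also have "\<dots> = (1 - (y $ 3)\<^sup>2) * (k (Z y))\<^sup>2"
      proof -
        have "Z y \<le> b" using w' unfolding Zy by blast
        then show ?thesis unfolding prof_Z by (simp add: k)
      qed
      finally have "y \<in> sphere 0 1" unfolding sphere Zy using k0 by simp
      moreover have "w = \<Phi> y"
        unfolding \<Phi>_def Zy using k0 by (simp add: y_def vec_eq_iff forall_3)
      ultimately show ?thesis by blast
    qed
  qed
  moreover have "inj_on \<Phi> (sphere 0 1)"
  proof (rule inj_onI)
    fix y y' assume y: "y \<in> sphere 0 1" "y' \<in> sphere 0 1" and eq: "\<Phi> y = \<Phi> y'"
    have "\<Phi> y $ i = \<Phi> y' $ i" for i using eq by simp
    from this[of 1] this[of 2] this[of 3]
    have eqs: "Z y = Z y'" "y $ 1 * k (Z y) = y' $ 1 * k (Z y')" "y $ 2 * k (Z y) = y' $ 2 * k (Z y')"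
      unfolding \<Phi>_def vector_3 by (simp_all only:)
    have 3: "y $ 3 = y' $ 3" using eqs(1) h by (simp add: Z_def)
    show "y = y'"
    proof (cases "k (Z y) = 0")
      case True
      then have "Z y = c" using h(1) by (simp add: k_def)
      then have "Z y = b" using Z(2)[OF y(1)] bc(1) by linarith
      then have "h * (y $ 3 - 1) = 0" unfolding Z_def h(2) by (simp add: algebra_simps)
      then have "y $ 3 = 1" "y' $ 3 = 1" using h(1) 3 by auto
      then have "y $ 1 = 0" "y $ 2 = 0" "y' $ 1 = 0" "y' $ 2 = 0"
        using y unfolding sphere by (simp_all add: sum_power2_eq_zero_iff)
      then show ?thesis using 3 by (simp add: vec_eq_iff forall_3)
    next
      case False
      then have "k (Z y') \<noteq> 0" unfolding eqs(1) .
      then have "y $ 1 = y' $ 1" "y $ 2 = y' $ 2"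
        using eqs(2,3) unfolding eqs(1) by simp_all
      then show ?thesis using 3 by (simp add: vec_eq_iff forall_3)
    qed
  qed
  moreover have "continuous_on (sphere 0 1) \<Phi>"
  proof -
    have "continuous_on (sphere 0 1) (\<lambda>y. \<Phi> y $ i)" for i
      using exhaust_3[of i] unfolding \<Phi>_def k_def Z_def
      by (elim disjE; simp only: vector_3; intro continuous_intros)
    then show ?thesis using continuous_on_vec_lambda[of "sphere 0 1" "\<lambda>i y. \<Phi> y $ i"] by simp
  qed
  ultimately have "sphere (0 :: real^3) 1 homeomorphic reduced_space j1 j2"
    by - (rule homeomorphic_compact[OF compact_sphere])
  then show ?thesis unfolding topological_sphere_def by (rule homeomorphic_sym[THEN iffD1])
qed

text \<open>The derivatives of this root and of its reciprocal are polynomials in the reciprocal, so the two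
  together generate a class of functions that is closed under derivatives.\<close>

definition height_root :: "real \<Rightarrow> real \<Rightarrow> real^3 \<Rightarrow> real" where
  "height_root k e w = sqrt (8 * (k + e * w $ 3))"

lemma closed_under_derivatives_height_root:
  "closed_under_derivatives {w. k + e * w $ 3 > 0}
    {height_root k e, \<lambda>w. 1 / height_root k e w}"
proof -
  let ?B = "{height_root k e, \<lambda>w. 1 / height_root k e w}"
  have gen: "polynomial_over ?B (\<lambda>w. 1 / height_root k e w)"
    by (rule polynomial_over.generator) simp
  have pos: "height_root k e x > 0" if "k + e * x $ 3 > 0" for x
    using that by (simp add: height_root_def)
  have nth: "((\<lambda>w::real^3. w $ i) has_derivative (\<lambda>v. v $ i)) (at p)" for i p
    by (intro bounded_linear_imp_has_derivative bounded_linear_vec_nth)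
  have d: "(height_root k e has_derivative (\<lambda>v. 4 * e * v $ 3 * (1 / height_root k e x))) (at x)"
    if "k + e * x $ 3 > 0" for x
    unfolding height_root_def using that
    by (auto intro!: derivative_eq_intros nth simp: fun_eq_iff divide_simps)
  have d': "((\<lambda>w. 1 / height_root k e w) has_derivative
      (\<lambda>v. - 4 * e * v $ 3 * (1 / height_root k e x) ^ 3)) (at x)"
    if "k + e * x $ 3 > 0" for x
    using pos[OF that]
    by (auto intro!: derivative_eq_intros d[OF that] simp: fun_eq_iff divide_simps power2_eq_square power3_eq_cube)
  have "\<exists>f'. (\<forall>x\<in>{w. k + e * w $ 3 > 0}. (height_root k e has_derivative f' x) (at x))
     \<and> (\<forall>v. polynomial_over ?B (\<lambda>x. f' x v))"
    by (rule exI[of _ "\<lambda>x v. 4 * e * v $ 3 * (1 / height_root k e x)"])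
      (intro conjI ballI allI polynomial_over_intros gen d; simp)
  moreover have "\<exists>f'. (\<forall>x\<in>{w. k + e * w $ 3 > 0}. ((\<lambda>w. 1 / height_root k e w) has_derivative f' x) (at x))
     \<and> (\<forall>v. polynomial_over ?B (\<lambda>x. f' x v))"
    by (rule exI[of _ "\<lambda>x v. - 4 * e * v $ 3 * (1 / height_root k e x) ^ 3"])
      (intro conjI ballI allI polynomial_over_intros gen d'; simp)
  ultimately show ?thesis unfolding closed_under_derivatives_def by simp
qed

text \<open>Near the apex the equation of the reduced space is \<open>w1\<^sup>2 + w2\<^sup>2 = 8 (w3 + j) (j - w3)\<^sup>2\<close>. Dividing
  the horizontal coordinates by the root of \<open>8 (w3 + j)\<close> turns it into the equation of a circular cone,
  and this change of coordinates has an explicit inverse.\<close>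

lemma conical_singularity_reduced_space:
  assumes j: "j > 0"
  shows "conical_singularity (reduced_space j (- j)) (vector [0, 0, j])"
proof -
  let ?U = "{w :: real^3. j + 1 * w $ 3 > 0}" and ?V = "{y :: real^3. 2 * j + (- 1) * y $ 3 > 0}"
  let ?r = "height_root j 1" and ?q = "height_root (2 * j) (- 1)"
  define \<phi> :: "real^3 \<Rightarrow> real^3" where
    "\<phi> w = vector [w $ 1 * (1 / ?r w), w $ 2 * (1 / ?r w), j - w $ 3]" for w
  define \<psi> :: "real^3 \<Rightarrow> real^3" where
    "\<psi> y = vector [y $ 1 * ?q y, y $ 2 * ?q y, j - y $ 3]" for y
  have r: "?r w > 0" "(?r w)\<^sup>2 = 8 * (w $ 3 + j)" if "w \<in> ?U" for w
    using that by (simp_all add: height_root_def)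
  have q: "?q y > 0" "(?q y)\<^sup>2 = 8 * (2 * j - y $ 3)" if "y \<in> ?V" for y
    using that by (simp_all add: height_root_def)
  have q\<phi>: "?q (\<phi> w) = ?r w" for w by (simp add: height_root_def \<phi>_def)
  have r\<psi>: "?r (\<psi> y) = ?q y" for y by (simp add: height_root_def \<psi>_def)
  have \<psi>\<phi>: "\<psi> (\<phi> w) = w" if "w \<in> ?U" for w
    unfolding \<psi>_def q\<phi> using r(1)[OF that] by (simp add: \<phi>_def vec_eq_iff forall_3)
  have \<phi>\<psi>: "\<phi> (\<psi> y) = y" if "y \<in> ?V" for y
    unfolding \<phi>_def r\<psi> using q(1)[OF that] by (simp add: \<psi>_def vec_eq_iff forall_3)
  have \<phi>V: "\<phi> w \<in> ?V" if "w \<in> ?U" for w using that by (simp add: \<phi>_def)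
  have \<psi>U: "\<psi> y \<in> ?U" if "y \<in> ?V" for y using that by (simp add: \<psi>_def)
  have gen: "polynomial_over {f, g} f" "polynomial_over {f, g} g" for f g
    by (auto intro: polynomial_over.generator)
  have smooth_\<phi>: "smooth_on ?U \<phi>"
  proof (rule smooth_on_polynomial_over_vec[OF closed_under_derivatives_height_root])
    show "polynomial_over {?r, \<lambda>w. 1 / ?r w} (\<lambda>w. \<phi> w $ i)" for i
      using exhaust_3[of i] unfolding \<phi>_def
      by (elim disjE; simp only: vector_3; intro polynomial_over_intros gen)
  qed
  have smooth_\<psi>: "smooth_on ?V \<psi>"
  proof (rule smooth_on_polynomial_over_vec[OF closed_under_derivatives_height_root])
    show "polynomial_over {?q, \<lambda>w. 1 / ?q w} (\<lambda>w. \<psi> w $ i)" for i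
      using exhaust_3[of i] unfolding \<psi>_def
      by (elim disjE; simp only: vector_3; intro polynomial_over_intros gen)
  qed
  have smooth_continuous: "continuous_on S f" if "smooth_on S f" for S and f :: "real^3 \<Rightarrow> real^3"
    using that by cases (blast intro: has_derivative_continuous continuous_at_imp_continuous_on)
  have homeo: "homeomorphism ?U ?V \<phi> \<psi>"
    unfolding homeomorphism_def
  proof (intro conjI ballI smooth_continuous smooth_\<phi> smooth_\<psi> \<psi>\<phi> \<phi>\<psi>; assumption?)
    show "\<phi> ` ?U = ?V" using \<phi>V \<psi>U \<phi>\<psi> by (metis (no_types, lifting) image_eqI image_subsetI subsetI subset_antisym)
    show "\<psi> ` ?V = ?U" using \<phi>V \<psi>U \<psi>\<phi> by (metis (no_types, lifting) image_eqI image_subsetI subsetI subset_antisym)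
  qed
  have image: "\<phi> ` (reduced_space j (- j) \<inter> ?U) = {y \<in> ?V. y $ 3 = sqrt ((y $ 1)\<^sup>2 + (y $ 2)\<^sup>2)}"
  proof (intro equalityI subsetI)
    fix y assume "y \<in> \<phi> ` (reduced_space j (- j) \<inter> ?U)"
    then obtain w where w: "w \<in> reduced_space j (- j)" "w \<in> ?U" and y: "y = \<phi> w" by blast
    have "(y $ 1)\<^sup>2 + (y $ 2)\<^sup>2 = ((w $ 1)\<^sup>2 + (w $ 2)\<^sup>2) / (?r w)\<^sup>2"
      by (simp add: y \<phi>_def power_divide add_divide_distrib)
    also have "\<dots> = (j - w $ 3)\<^sup>2"
      using w r[OF w(2)] by (simp add: reduced_space_iff profile_conical)
    finally show "y \<in> {y \<in> ?V. y $ 3 = sqrt ((y $ 1)\<^sup>2 + (y $ 2)\<^sup>2)}"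
      using \<phi>V[OF w(2)] w(1) by (simp add: y \<phi>_def reduced_space_iff)
  next
    fix y assume "y \<in> {y \<in> ?V. y $ 3 = sqrt ((y $ 1)\<^sup>2 + (y $ 2)\<^sup>2)}"
    then have y: "y \<in> ?V" "y $ 3 = sqrt ((y $ 1)\<^sup>2 + (y $ 2)\<^sup>2)" by auto
    then have "0 \<le> y $ 3" by simp
    have y2: "(y $ 3)\<^sup>2 = (y $ 1)\<^sup>2 + (y $ 2)\<^sup>2" unfolding y(2) by simp
    have "(\<psi> y $ 1)\<^sup>2 + (\<psi> y $ 2)\<^sup>2 = ((y $ 1)\<^sup>2 + (y $ 2)\<^sup>2) * (?q y)\<^sup>2"
      by (simp add: \<psi>_def power_mult_distrib algebra_simps)
    also have "\<dots> = profile j (- j) (\<psi> y $ 3)"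
      unfolding q(2)[OF y(1)] y2[symmetric] profile_conical by (simp add: \<psi>_def)
    finally have "\<psi> y \<in> reduced_space j (- j)"
      using y(1) \<open>0 \<le> y $ 3\<close> by (simp add: reduced_space_iff \<psi>_def)
    then show "y \<in> \<phi> ` (reduced_space j (- j) \<inter> ?U)"
      using \<psi>U[OF y(1)] \<phi>\<psi>[OF y(1)] by (metis IntI image_eqI)
  qed
  have "open ?U" "open ?V" by (intro open_Collect_less continuous_intros)+
  moreover have "vector [0, 0, j] \<in> ?U" "\<phi> (vector [0, 0, j]) = 0"
    using j by (simp_all add: \<phi>_def vec_eq_iff forall_3)
  ultimately show ?thesis
    unfolding conical_singularity_def using homeo smooth_\<phi> smooth_\<psi> image by blast
qed

lemma sphere_with_conical_singularity_reduced_space: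
  assumes "j > 0"
  shows "sphere_with_conical_singularity (reduced_space j (- j)) (vector [0, 0, j])"
  unfolding sphere_with_conical_singularity_def
proof (intro conjI ballI)
  show "topological_sphere (reduced_space j (- j))"
    using assms by (intro topological_sphere_reduced_space) auto
  show "vector [0, 0, j] \<in> reduced_space j (- j)"
    using assms by (simp add: reduced_space_iff profile_conical)
  show "conical_singularity (reduced_space j (- j)) (vector [0, 0, j])"
    by (rule conical_singularity_reduced_space[OF assms])
  fix q :: "real^3" assume q: "q \<in> reduced_space j (- j) - {vector [0, 0, j]}"
  have "q = vector [0, 0, j]" if "q $ 3 = j"
    using q that by (intro vec3_eqI) (auto simp: reduced_space_iff profile_conical sum_power2_eq_zero_iff)
  then show "smooth_surface_at (reduced_space j (- j)) q"
    using q assms by (intro smooth_surface_at_reduced_space) auto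
qed

lemma compact_reduced_space:
  assumes "j1 > 0" "j2 < j1"
  shows "compact (reduced_space j1 j2)"
  using topological_sphere_reduced_space[OF assms] homeomorphic_compactness compact_sphere
  unfolding topological_sphere_def by blast

section \<open>Lyapunov stability\<close>

text \<open>The image under the energy of the points at distance at least \<open>e\<close> from \<open>m\<close> is closed and omits the
  energy of \<open>m\<close>; a trajectory that starts with an energy outside this image can never enter that set.\<close>

lemma lyapunov_stableI:
  assumes "compact (reduced_space j1 j2)" "\<kappa> \<noteq> 0"
    and sep: "\<And>w. w \<in> reduced_space j1 j2 \<Longrightarrow>
      w $ 2 + 2 * a / \<kappa> * w $ 3 = m $ 2 + 2 * a / \<kappa> * m $ 3 \<Longrightarrow> w = m"
  shows "lyapunov_stable (drift_hamiltonian I I \<kappa> a) j1 j2 m"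
  unfolding lyapunov_stable_def
proof (intro allI impI)
  fix e :: real assume "e > 0"
  define g where "g w = \<kappa> / 2 * w $ 2 + a * w $ 3" for w :: "real^3"
  define K where "K = reduced_space j1 j2 \<inter> {w. e \<le> dist w m}"
  have g: "continuous_on S g" for S unfolding g_def by (intro continuous_intros)
  have gsep: "w = m" if "w \<in> reduced_space j1 j2" "g w = g m" for w
  proof (rule sep[OF that(1)])
    have "2 / \<kappa> * g w = 2 / \<kappa> * g m" using that(2) by simp
    then show "w $ 2 + 2 * a / \<kappa> * w $ 3 = m $ 2 + 2 * a / \<kappa> * m $ 3"
      using assms(2) by (simp add: g_def field_simps)
  qed
  have "compact K"
    unfolding K_def using assms(1)
    by (intro compact_Int_closed closed_Collect_le continuous_intros)
  then have "closed (g ` K)" using compact_continuous_image[OF g] compact_imp_closed by blast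
  then have "open (g -` (- g ` K))"
    using g[of UNIV] by (intro open_vimage) auto
  moreover have "m \<in> g -` (- g ` K)"
  proof -
    have "g w \<noteq> g m" if "w \<in> K" for w
    proof
      assume "g w = g m"
      then have "w = m" using gsep that unfolding K_def by blast
      then show False using that \<open>e > 0\<close> unfolding K_def by simp
    qed
    then show ?thesis by (metis ComplI imageE vimageI)
  qed
  ultimately obtain d where d: "d > 0" "ball m d \<subseteq> g -` (- g ` K)"
    using openE by blast
  show "\<exists>d>0. \<forall>c. reduced_trajectory (drift_hamiltonian I I \<kappa> a) j1 j2 c \<longrightarrow> dist (c 0) m < d \<longrightarrow>
      (\<forall>t\<ge>0. dist (c t) m < e)"
  proof (intro exI[of _ d] conjI allI impI d(1))
    fix c and t :: real
    assume c: "reduced_trajectory (drift_hamiltonian I I \<kappa> a) j1 j2 c" and 0: "dist (c 0) m < d"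
    have "g (c t) = g (c 0)" using reduced_energy_conserved[OF c] by (simp add: g_def)
    moreover have "g (c 0) \<notin> g ` K" using 0 d by (auto simp: dist_commute)
    ultimately have "c t \<notin> K" by (metis imageI)
    then show "dist (c t) m < e"
      using reduced_trajectory_equations(1)[OF c] by (auto simp: K_def)
  qed
qed

text \<open>The line through the apex is at least as steep as the cone, and the meridian is flatter than its
  tangents at the apex.\<close>

lemma below_apex_tangents:
  assumes "z < j" "l\<^sup>2 \<ge> 16 * j"
  shows "profile j (- j) z < (l * (j - z))\<^sup>2"
proof -
  have "8 * (z + j) * (j - z)\<^sup>2 < l\<^sup>2 * (j - z)\<^sup>2"
    using assms by (intro mult_strict_right_mono) auto
  then show ?thesis by (simp add: profile_conical power_mult_distrib)
qed

lemma lyapunov_stable_regular: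
  assumes "j1 > 0" "j2 < j1" "\<kappa> \<noteq> 0" "m \<in> equilibria (drift_hamiltonian I I \<kappa> a) j1 j2" "m $ 2 \<noteq> 0"
  shows "lyapunov_stable (drift_hamiltonian I I \<kappa> a) j1 j2 m"
proof (rule lyapunov_stableI)
  show "compact (reduced_space j1 j2)" by (rule compact_reduced_space[OF assms(1,2)])
  fix w assume "w \<in> reduced_space j1 j2"
    "w $ 2 + 2 * a / \<kappa> * w $ 3 = m $ 2 + 2 * a / \<kappa> * m $ 3"
  then show "w = m"
    using assms equilibria_iff_tangency[of j1 \<kappa> m I a j2]
    by (intro tangency_separates[of j2 j1 "2 * a / \<kappa>" m w]) auto
qed (rule assms)

lemma lyapunov_stable_apex:
  assumes j: "j > 0" and "\<kappa> \<noteq> 0" and l: "(2 * a / \<kappa>)\<^sup>2 \<ge> 16 * j"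
  shows "lyapunov_stable (drift_hamiltonian I I \<kappa> a) j (- j) (vector [0, 0, j])"
proof (rule lyapunov_stableI)
  show "compact (reduced_space j (- j))" using j by (intro compact_reduced_space) auto
  fix w :: "real^3" assume w: "w \<in> reduced_space j (- j)"
    and "w $ 2 + 2 * a / \<kappa> * w $ 3 = (vector [0, 0, j] :: real^3) $ 2 + 2 * a / \<kappa> * (vector [0, 0, j] :: real^3) $ 3"
  then have w2: "w $ 2 = 2 * a / \<kappa> * (j - w $ 3)" by (simp add: algebra_simps diff_divide_distrib)
  have w': "(w $ 1)\<^sup>2 + (w $ 2)\<^sup>2 = profile j (- j) (w $ 3)" "w $ 3 \<le> j"
    using w by (auto simp: reduced_space_iff)
  have "(w $ 2)\<^sup>2 \<le> profile j (- j) (w $ 3)" using w'(1) zero_le_power2[of "w $ 1"] by linarith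
  then have "\<not> w $ 3 < j" using below_apex_tangents[OF _ l, of "w $ 3"] unfolding w2 by linarith
  then have "w $ 3 = j" using w' by simp
  then show "w = vector [0, 0, j]"
    using w' by (intro vec3_eqI) (auto simp: profile_conical sum_power2_eq_zero_iff)
qed (rule assms)

section \<open>The homoclinic orbit\<close>

text \<open>The curve on the energy plane through the apex that is obtained by integrating
  \<open>y' = - \<kappa>/4 (b\<^sup>2 - y\<^sup>2)\<close> for \<open>y = w1 / (j - w3)\<close>.\<close>

definition homoclinic_curve :: "real \<Rightarrow> real \<Rightarrow> real \<Rightarrow> real \<Rightarrow> real \<Rightarrow> real^3" where
  "homoclinic_curve \<kappa> j l b t = (let v = b\<^sup>2 / 8 * (1 / cosh (\<kappa> * b / 4 * t))\<^sup>2 in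
     vector [- b * tanh (\<kappa> * b / 4 * t) * v, l * v, j - v])"

lemma sech_square: "(1 / cosh x)\<^sup>2 = 1 - (tanh x)\<^sup>2" for x :: real
proof -
  have "(sinh x)\<^sup>2 = (cosh x)\<^sup>2 - 1" by (simp add: cosh_square_eq)
  then show ?thesis by (simp add: tanh_def power_divide diff_divide_distrib)
qed

lemma tanh_artanh_real:
  assumes "\<bar>x\<bar> < 1"
  shows "tanh (artanh x) = (x :: real)"
proof -
  define r where "r = (1 + x) / (1 - x)"
  have x: "1 + x > 0" "1 - x > 0" using assms by auto
  then have r: "r > 0" by (simp add: r_def)
  then have "artanh x = ln (sqrt r)" by (simp add: artanh_def r_def ln_sqrt)
  then have "tanh (artanh x) = (r - 1) / (r + 1)" using r by (simp add: tanh_ln_real)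
  also have "\<dots> = x" using x by (simp add: r_def field_simps)
  finally show ?thesis .
qed

text \<open>The lift is found with complex \<open>X = x1 + i x2\<close> and \<open>P = \<pi>\<^sub>1 + i \<pi>\<^sub>2\<close>. As \<open>cnj X * P = (w2 + i w1) / 2\<close>
  and \<open>|X|\<^sup>2 = 2 (j - \<pi>\<^sub>3)\<close>, the curve determines \<open>P = X (l - i b tanh) / 4\<close>. Then \<open>X' = - i \<kappa> P\<close> becomes
  a linear equation for \<open>X\<close>, with solution \<open>X = (b/2) sech (\<mu> t) exp (- i a t / 2)\<close> for \<open>\<mu> = \<kappa> b / 4\<close>.\<close>

lemma homoclinic_curve_trajectory:
  assumes "\<kappa> > 0" "j > 0" "l = 2 * a / \<kappa>" "b > 0" "b\<^sup>2 = 16 * j - l\<^sup>2"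
  shows "reduced_trajectory (drift_hamiltonian I I \<kappa> a) j (- j) (homoclinic_curve \<kappa> j l b)"
proof -
  define \<mu> where "\<mu> = \<kappa> * b / 4"
  define S T C N where "S t = 1 / cosh (\<mu> * t)" and "T t = tanh (\<mu> * t)"
    and "C t = cos (a / 2 * t)" and "N t = sin (a / 2 * t)" for t
  have a: "a = \<kappa> * l / 2" and j: "j = (b\<^sup>2 + l\<^sup>2) / 16"
    using assms by simp_all
  have ST: "(S t)\<^sup>2 + (T t)\<^sup>2 = 1" and CN: "(C t)\<^sup>2 + (N t)\<^sup>2 = 1" for t
    unfolding S_def T_def C_def N_def sech_square by simp_all
  have cosh0: "cosh x \<noteq> 0" for x :: real by (metis cosh_real_pos less_irrefl)
  have dS: "(S has_real_derivative - \<mu> * S t * T t) (at t)" for t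
    unfolding S_def T_def using cosh0
    by (auto intro!: derivative_eq_intros simp: tanh_def power2_eq_square)
  have dT: "(T has_real_derivative \<mu> * (S t)\<^sup>2) (at t)" for t
    unfolding S_def sech_square unfolding T_def using cosh0
    by (auto intro!: derivative_eq_intros)
  have dC: "(C has_real_derivative - (a / 2 * N t)) (at t)"
    and dN: "(N has_real_derivative a / 2 * C t) (at t)" for t
    unfolding C_def N_def by (auto intro!: derivative_eq_intros)
  define u :: "real \<Rightarrow> state" where "u t =
    (vector [b / 2 * S t * C t, - (b / 2 * S t * N t)],
     vector [b / 8 * S t * (l * C t - b * T t * N t), - (b / 8 * S t * (l * N t + b * T t * C t)),
       j - b\<^sup>2 / 8 * (S t)\<^sup>2])" for t
  have "is_solution (SO3_reduced (drift_hamiltonian I I \<kappa> a)) u"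
    unfolding is_solution_drift_iff u_def fst_conv snd_conv vector_2 vector_3
    apply (intro allI conjI)
    subgoal for t by (rule derivative_eq_intros dS dT dC dN refl)+ (use ST[of t] CN[of t] in \<open>simp add: a j \<mu>_def field_simps; algebra\<close>)
    subgoal for t by (rule derivative_eq_intros dS dT dC dN refl)+ (use ST[of t] CN[of t] in \<open>simp add: a j \<mu>_def field_simps; algebra\<close>)
    subgoal for t by (rule derivative_eq_intros dS dT dC dN refl)+ (use ST[of t] CN[of t] in \<open>simp add: a j \<mu>_def field_simps; algebra\<close>)
    subgoal for t by (rule derivative_eq_intros dS dT dC dN refl)+ (use ST[of t] CN[of t] in \<open>simp add: a j \<mu>_def field_simps; algebra\<close>)
    subgoal for t by (rule derivative_eq_intros dS dT dC dN refl)+ (use ST[of t] CN[of t] in \<open>simp add: a j \<mu>_def field_simps; algebra\<close>)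
    done
  moreover have "u t \<in> momentum_level j (- j)" for t
    unfolding u_def momentum_level_iff vector_2 vector_3
    apply (intro conjI)
    subgoal using assms by simp
    subgoal
    proof -
      have "(b / 8 * S t * (l * C t - b * T t * N t))\<^sup>2 + (- (b / 8 * S t * (l * N t + b * T t * C t)))\<^sup>2
          = (b / 8 * S t)\<^sup>2 * (l\<^sup>2 + b\<^sup>2 * (T t)\<^sup>2) * ((C t)\<^sup>2 + (N t)\<^sup>2)"
        by (simp add: power2_eq_square field_simps)
      also have "\<dots> = (b / 8 * S t)\<^sup>2 * (l\<^sup>2 + b\<^sup>2 * (1 - (S t)\<^sup>2))"
        using CN[of t] ST[of t] by (simp add: eq_diff_eq')
      also have "\<dots> = j\<^sup>2 - (j - b\<^sup>2 / 8 * (S t)\<^sup>2)\<^sup>2"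
        unfolding j by (simp add: power2_eq_square field_simps)
      finally show ?thesis by simp
    qed
    subgoal
    proof -
      have "(b / 2 * S t * C t)\<^sup>2 + (- (b / 2 * S t * N t))\<^sup>2 = (b / 2 * S t)\<^sup>2 * ((C t)\<^sup>2 + (N t)\<^sup>2)"
        by (simp add: power2_eq_square field_simps)
      then show ?thesis unfolding CN by (simp add: power2_eq_square field_simps)
    qed
    done
  moreover have "circle_reduction (u t) = homoclinic_curve \<kappa> j l b t" for t
    unfolding u_def homoclinic_curve_def Let_def \<mu>_def[symmetric] S_def[symmetric] T_def[symmetric]
      circle_reduction_def split vec_eq_iff forall_3 vector_2 vector_3
    apply (intro conjI)
    subgoal using CN[of t] by (simp add: field_simps; algebra)
    subgoal using CN[of t] by (simp add: field_simps; algebra)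
    subgoal ..
    done
  ultimately show ?thesis
    unfolding reduced_trajectory_def by (intro exI[of _ u]) auto
qed

text \<open>The squared slope \<open>(w1 / (j - w3))\<^sup>2\<close> is linear in the height: the plane section is a nodal cubic
  with node at the apex, and the slope is its rational parameter.\<close>

lemma apex_energy_level:
  assumes "w \<in> reduced_space j (- j)" "w $ 2 + l * w $ 3 = l * j" "w \<noteq> vector [0, 0, j]"
    "b\<^sup>2 = 16 * j - l\<^sup>2"
  shows "w $ 3 < j" "w $ 2 = l * (j - w $ 3)" "(w $ 1 / (j - w $ 3))\<^sup>2 = b\<^sup>2 - 8 * (j - w $ 3)"
proof -
  have w: "(w $ 1)\<^sup>2 + (w $ 2)\<^sup>2 = 8 * (w $ 3 + j) * (j - w $ 3)\<^sup>2" "w $ 3 \<le> j"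
    using assms(1) by (auto simp: reduced_space_iff profile_conical)
  show w2: "w $ 2 = l * (j - w $ 3)" using assms(2) by (simp add: algebra_simps)
  have "w $ 3 \<noteq> j"
  proof
    assume "w $ 3 = j"
    then have "w = vector [0, 0, j]" using w w2 by (auto intro!: vec3_eqI)
    then show False using assms(3) by simp
  qed
  then show lt: "w $ 3 < j" using w by simp
  have "(w $ 1)\<^sup>2 = (b\<^sup>2 - 8 * (j - w $ 3)) * (j - w $ 3)\<^sup>2"
    using w(1) assms(4) unfolding w2 by algebra
  then show "(w $ 1 / (j - w $ 3))\<^sup>2 = b\<^sup>2 - 8 * (j - w $ 3)"
    using lt by (simp add: power_divide)
qed

text \<open>The slope \<open>y = w1 / (j - w3)\<close> satisfies \<open>y' = - \<kappa>/4 (b\<^sup>2 - y\<^sup>2)\<close>, so \<open>artanh (y / b) + \<kappa> b t / 4\<close> is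
  constant, and \<open>y\<close> determines all three coordinates.\<close>

lemma apex_energy_trajectory:
  assumes \<kappa>: "\<kappa> > 0" and l: "l = 2 * a / \<kappa>" and b: "b > 0" "b\<^sup>2 = 16 * j - l\<^sup>2"
    and c: "reduced_trajectory (drift_hamiltonian I I \<kappa> a) j (- j) c"
    and ne: "\<And>t. c t \<noteq> vector [0, 0, j]"
    and energy: "\<And>t. c t $ 2 + l * c t $ 3 = l * j"
  shows "\<exists>\<tau>. \<forall>t. c t = homoclinic_curve \<kappa> j l b (t - \<tau>)"
proof -
  define v where "v t = j - c t $ 3" for t
  define y where "y t = c t $ 1 / v t" for t
  note eqs = reduced_trajectory_equations[OF c]
  note lev = apex_energy_level[OF eqs(1) energy ne b(2), folded v_def]
  have v: "v t > 0" for t using lev(1)[of t] by (simp add: v_def)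
  have y2: "(y t)\<^sup>2 = b\<^sup>2 - 8 * v t" for t using lev(3)[of t] by (simp add: y_def)
  have c1: "c t $ 1 = y t * v t" for t using v[of t] by (simp add: y_def)
  have l': "\<kappa> * l = 2 * a" using l \<kappa> by simp
  have dv: "(v has_real_derivative \<kappa> / 2 * c t $ 1) (at t)" for t
    unfolding v_def by (rule derivative_eq_intros eqs refl)+ simp
  have dy: "(y has_real_derivative - (\<kappa> / 4) * (b\<^sup>2 - (y t)\<^sup>2)) (at t)" for t
  proof -
    have w1': "- (\<kappa> / 4 * profile_slope j (- j) (c t $ 3) + a * c t $ 2)
        = v t * (2 * \<kappa> * (4 * j - 3 * v t) - a * l)"
      unfolding profile_slope_conical lev(2) unfolding v_def by (simp add: algebra_simps)
    have "(y has_real_derivative (- (\<kappa> / 4 * profile_slope j (- j) (c t $ 3) + a * c t $ 2) * v t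
        - c t $ 1 * (\<kappa> / 2 * c t $ 1)) / (v t * v t)) (at t)"
      unfolding y_def using v[of t] by (intro DERIV_divide eqs dv) simp
    moreover have "(- (\<kappa> / 4 * profile_slope j (- j) (c t $ 3) + a * c t $ 2) * v t
        - c t $ 1 * (\<kappa> / 2 * c t $ 1)) / (v t * v t)
        = 2 * \<kappa> * (4 * j - 3 * v t) - a * l - \<kappa> / 2 * (y t)\<^sup>2"
      unfolding w1' c1 using v[of t] by (simp add: field_simps power2_eq_square)
    moreover have "\<dots> = - (\<kappa> / 4) * (b\<^sup>2 - (y t)\<^sup>2)"
      using y2[of t] b(2) l' by algebra
    ultimately show ?thesis by simp
  qed
  define \<mu> where "\<mu> = \<kappa> * b / 4"
  have \<mu>: "\<mu> > 0" using \<kappa> b by (simp add: \<mu>_def)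
  have yb: "\<bar>y t / b\<bar> < 1" for t
  proof -
    have "(y t)\<^sup>2 < b\<^sup>2" using y2[of t] v[of t] by simp
    then have "\<bar>y t\<bar> < \<bar>b\<bar>" by (metis abs_le_square_iff not_le)
    then show ?thesis using b by simp
  qed
  have "((\<lambda>t. artanh (y t / b) + \<mu> * t) has_real_derivative 0) (at t)" for t
  proof -
    have "b\<^sup>2 - (y t)\<^sup>2 \<noteq> 0" using y2[of t] v[of t] by simp
    then have "1 / (1 - (y t / b)\<^sup>2) * ((- (\<kappa> / 4) * (b\<^sup>2 - (y t)\<^sup>2)) / b) + \<mu> = 0"
      using b by (simp add: \<mu>_def field_simps power2_eq_square)
    moreover have "((\<lambda>t. artanh (y t / b) + \<mu> * t) has_real_derivative
        1 / (1 - (y t / b)\<^sup>2) * ((- (\<kappa> / 4) * (b\<^sup>2 - (y t)\<^sup>2)) / b) + \<mu> * 1) (at t)"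
      by (intro DERIV_add DERIV_chain2[OF artanh_real_has_field_derivative] DERIV_cdivide dy yb
          DERIV_cmult DERIV_ident)
    ultimately show ?thesis by simp
  qed
  then have const: "artanh (y t / b) + \<mu> * t = artanh (y 0 / b) + \<mu> * 0" for t
    by (rule DERIV_isconst_all[rule_format])
  define \<tau> where "\<tau> = artanh (y 0 / b) / \<mu>"
  have "c t = homoclinic_curve \<kappa> j l b (t - \<tau>)" for t
  proof -
    have "artanh (y t / b) = - (\<mu> * (t - \<tau>))" using const[of t] \<mu> by (simp add: \<tau>_def algebra_simps)
    then have "y t / b = - tanh (\<mu> * (t - \<tau>))"
      using tanh_artanh_real[OF yb, of t] by (metis tanh_minus)
    then have y: "y t = - b * tanh (\<mu> * (t - \<tau>))" using b by (simp add: field_simps)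
    have vt: "v t = b\<^sup>2 / 8 * (1 / cosh (\<mu> * (t - \<tau>)))\<^sup>2"
      unfolding sech_square using y2[of t] unfolding y by (simp add: field_simps power_mult_distrib)
    show ?thesis
      unfolding homoclinic_curve_def Let_def \<mu>_def[symmetric] vt[symmetric]
      using c1[of t] lev(2)[of t] unfolding y by (intro vec3_eqI) (simp_all add: v_def)
  qed
  then show ?thesis by blast
qed

lemma homoclinic_curve_tendsto:
  assumes "((\<lambda>t. tanh (\<kappa> * b / 4 * t)) \<longlongrightarrow> e) F" "e\<^sup>2 = 1"
  shows "(homoclinic_curve \<kappa> j l b \<longlongrightarrow> vector [0, 0, j]) F"
proof -
  have v: "((\<lambda>t. b\<^sup>2 / 8 * (1 / cosh (\<kappa> * b / 4 * t))\<^sup>2) \<longlongrightarrow> b\<^sup>2 / 8 * (1 - e\<^sup>2)) F"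
    unfolding sech_square by (intro tendsto_intros assms(1))
  have v: "((\<lambda>t. b\<^sup>2 / 8 * (1 / cosh (\<kappa> * b / 4 * t))\<^sup>2) \<longlongrightarrow> 0) F"
    using v assms(2) by simp
  have "((\<lambda>t. homoclinic_curve \<kappa> j l b t $ i) \<longlongrightarrow> vector [- b * e * 0, l * 0, j - 0] $ i) F" for i
    using exhaust_3[of i] unfolding homoclinic_curve_def Let_def
    by (elim disjE; simp only: vector_3; intro tendsto_intros v assms(1))
  then show ?thesis using vec_tendstoI[of "homoclinic_curve \<kappa> j l b" "vector [- b * e * 0, l * 0, j - 0]" F] by simp
qed

lemma homoclinic_curve_ne:
  assumes "b > 0"
  shows "homoclinic_curve \<kappa> j l b t \<noteq> vector [0, 0, j]"
proof -
  have "cosh x \<noteq> 0" for x :: real by (metis cosh_real_pos less_irrefl)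
  then show ?thesis using assms by (simp add: homoclinic_curve_def Let_def vec_eq_iff forall_3)
qed

text \<open>By continuity a trajectory that tends to the apex has the energy of the apex, and
  \<open>apex_energy_trajectory\<close> applies.\<close>

lemma homoclinic_orbit_iff:
  assumes \<kappa>: "\<kappa> > 0" and j: "j > 0" and l: "l = 2 * a / \<kappa>" and b: "b > 0" "b\<^sup>2 = 16 * j - l\<^sup>2"
  shows "homoclinic_orbit (drift_hamiltonian I I \<kappa> a) j (- j) (vector [0, 0, j]) X \<longleftrightarrow>
    X = range (homoclinic_curve \<kappa> j l b)"
proof
  let ?s = "vector [0, 0, j] :: real^3"
  assume "homoclinic_orbit (drift_hamiltonian I I \<kappa> a) j (- j) ?s X"
  then obtain c where c: "reduced_trajectory (drift_hamiltonian I I \<kappa> a) j (- j) c"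
    and ne: "\<And>t. c t \<noteq> ?s" and lim: "(c \<longlongrightarrow> ?s) at_top" and X: "X = range c"
    unfolding homoclinic_orbit_def by blast
  have "((\<lambda>t. \<kappa> / 2 * c t $ 2 + a * c t $ 3) \<longlongrightarrow> \<kappa> / 2 * ?s $ 2 + a * ?s $ 3) at_top"
    by (intro tendsto_intros lim)
  moreover have "(\<lambda>t. \<kappa> / 2 * c t $ 2 + a * c t $ 3) = (\<lambda>t. \<kappa> / 2 * c 0 $ 2 + a * c 0 $ 3)"
    using reduced_energy_conserved[OF c] by (rule ext)
  ultimately have "((\<lambda>t::real. \<kappa> / 2 * c 0 $ 2 + a * c 0 $ 3) \<longlongrightarrow> a * j) at_top"
    by simp
  then have "\<kappa> / 2 * c 0 $ 2 + a * c 0 $ 3 = a * j" by (simp add: tendsto_const_iff)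
  then have "\<kappa> / 2 * c t $ 2 + a * c t $ 3 = a * j" for t using reduced_energy_conserved[OF c, of t] by simp
  moreover have "2 / \<kappa> * (\<kappa> / 2 * x + a * z) = x + l * z" for x z
    using \<kappa> by (simp add: l field_simps)
  ultimately have "c t $ 2 + l * c t $ 3 = 2 / \<kappa> * (a * j)" for t by metis
  then have "c t $ 2 + l * c t $ 3 = l * j" for t by (simp add: l)
  then have "\<exists>\<tau>. \<forall>t. c t = homoclinic_curve \<kappa> j l b (t - \<tau>)"
    by (rule apex_energy_trajectory[OF \<kappa> l b c ne])
  then obtain \<tau> where \<tau>: "\<forall>t. c t = homoclinic_curve \<kappa> j l b (t - \<tau>)" ..
  have "X = homoclinic_curve \<kappa> j l b ` range (\<lambda>t. t - \<tau>)"
    unfolding X image_image using \<tau> by simp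
  also have "range (\<lambda>t. t - \<tau>) = UNIV" by (rule surjI[of _ "\<lambda>t. t + \<tau>"]) simp
  finally show "X = range (homoclinic_curve \<kappa> j l b)" .
next
  have "filterlim (\<lambda>t. \<kappa> * b / 4 * t) at_top at_top" "filterlim (\<lambda>t. \<kappa> * b / 4 * t) at_bot at_bot"
    using filterlim_tendsto_pos_mult_at_top[OF tendsto_const _ filterlim_ident, of "\<kappa> * b / 4"]
      filterlim_tendsto_pos_mult_at_bot[OF tendsto_const _ filterlim_ident, of "\<kappa> * b / 4"] \<kappa> b(1)
    by simp_all
  note lim = this
  assume "X = range (homoclinic_curve \<kappa> j l b)"
  then show "homoclinic_orbit (drift_hamiltonian I I \<kappa> a) j (- j) (vector [0, 0, j]) X"
    unfolding homoclinic_orbit_def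
    using homoclinic_curve_trajectory[OF \<kappa> j l b] homoclinic_curve_ne[OF b(1)]
      homoclinic_curve_tendsto[OF filterlim_compose[OF tanh_real_at_top lim(1)]]
      homoclinic_curve_tendsto[OF filterlim_compose[OF tanh_real_at_bot lim(2)]]
    by (intro exI[of _ "homoclinic_curve \<kappa> j l b"]) simp
qed

text \<open>Translates in time of the homoclinic trajectory start arbitrarily close to \<open>m\<close> and later pass
  through the same point.\<close>

lemma homoclinic_unstable:
  assumes "homoclinic_orbit (drift_hamiltonian I I \<kappa> a) j1 j2 m X"
  shows "\<not> lyapunov_stable (drift_hamiltonian I I \<kappa> a) j1 j2 m"
proof
  assume st: "lyapunov_stable (drift_hamiltonian I I \<kappa> a) j1 j2 m"
  obtain c where c: "reduced_trajectory (drift_hamiltonian I I \<kappa> a) j1 j2 c"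
    and ne: "c 0 \<noteq> m" and lim: "(c \<longlongrightarrow> m) at_bot"
    using assms unfolding homoclinic_orbit_def by blast
  have "dist (c 0) m > 0" using ne by simp
  then obtain d where d: "d > 0"
    "\<And>c' t. reduced_trajectory (drift_hamiltonian I I \<kappa> a) j1 j2 c' \<Longrightarrow> dist (c' 0) m < d \<Longrightarrow> t \<ge> 0
      \<Longrightarrow> dist (c' t) m < dist (c 0) m"
    using st unfolding lyapunov_stable_def by blast
  have "eventually (\<lambda>t. dist (c t) m < d) at_bot" using lim d(1) by (rule tendstoD)
  moreover have "eventually (\<lambda>t::real. t \<le> 0) at_bot" by (rule eventually_le_at_bot)
  ultimately have "eventually (\<lambda>t. dist (c t) m < d \<and> t \<le> 0) at_bot" by (rule eventually_conj)
  then obtain T where T: "dist (c T) m < d" "T \<le> 0"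
    using eventually_happens'[OF trivial_limit_at_bot_linorder] by blast
  show False
    using d(2)[OF reduced_trajectory_shift[OF c, of T], of "- T"] T by simp
qed

section \<open>Equilibria, stability and connections of the reduced flow\<close>

theorem mainTheorem7:
  fixes I1 I2 \<kappa> a j1 j2 :: real
  assumes "I1 = I2" and "\<kappa> > 0" and "j1 \<ge> 0" and "j2 \<le> j1"
  shows
    "let H = drift_hamiltonian I1 I2 \<kappa> a;
         M = reduced_space j1 j2;
         E = equilibria H j1 j2;
         s = (vector [0, 0, j1] :: real^3)
     in
       (\<forall>c. reduced_trajectory H j1 j2 c \<longrightarrow>
          (\<exists>C. range c \<subseteq> M \<inter> {w. \<kappa> / 2 * w$2 + a * w$3 = C}))
     \<and> (j1 > 0 \<and> j2 < j1 \<and> j2 \<noteq> - j1 \<longrightarrow>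
          smooth_sphere M \<and> card E = 2 \<and> (\<forall>m\<in>E. lyapunov_stable H j1 j2 m))
     \<and> (- j2 = j1 \<and> j1 > 0 \<longrightarrow> sphere_with_conical_singularity M s)
     \<and> (- j2 = j1 \<and> j1 > 0 \<and> a\<^sup>2 < 4 * \<kappa>\<^sup>2 * j1 \<longrightarrow>
          s \<in> E \<and> \<not> lyapunov_stable H j1 j2 s \<and> (\<exists>!X. homoclinic_orbit H j1 j2 s X)
          \<and> card (E - {s}) = 2 \<and> (\<forall>m\<in>E - {s}. lyapunov_stable H j1 j2 m))
     \<and> (- j2 = j1 \<and> j1 > 0 \<and> a\<^sup>2 \<ge> 4 * \<kappa>\<^sup>2 * j1 \<longrightarrow>
          card E = 2 \<and> s \<in> E \<and> (\<forall>m\<in>E. lyapunov_stable H j1 j2 m))"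
proof -
  define H where "H = drift_hamiltonian I1 I2 \<kappa> a"
  define M where "M = reduced_space j1 j2"
  define E where "E = equilibria H j1 j2"
  define s :: "real^3" where "s = vector [0, 0, j1]"
  define l where "l = 2 * a / \<kappa>"
  define R where "R = {w :: real^3. w $ 1 = 0 \<and> w $ 2 \<noteq> 0 \<and> tangency j1 j2 l (w $ 2) (w $ 3)}"
  have H: "H = drift_hamiltonian I1 I1 \<kappa> a" using assms(1) by (simp add: H_def)
  have \<kappa>: "\<kappa> \<noteq> 0" using assms(2) by simp
  have E: "w \<in> E \<longleftrightarrow> w $ 1 = 0 \<and> tangency j1 j2 l (w $ 2) (w $ 3)" for w
    unfolding E_def H l_def by (rule equilibria_iff_tangency[OF assms(3) \<kappa>])
  have stable: "lyapunov_stable H j1 j2 m" if "j1 > 0" "j2 < j1" "m \<in> R" for m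
    using that E[of m] lyapunov_stable_regular[OF that(1,2) \<kappa>]
    unfolding E_def R_def H by blast
  have planes: "\<exists>C. range c \<subseteq> M \<inter> {w. \<kappa> / 2 * w$2 + a * w$3 = C}" if "reduced_trajectory H j1 j2 c" for c
    using reduced_energy_conserved[OF that[unfolded H]] reduced_trajectory_equations(1)[OF that[unfolded H]]
    by (intro exI[of _ "\<kappa> / 2 * c 0 $ 2 + a * c 0 $ 3"]) (auto simp: M_def)
  have regular: "smooth_sphere M \<and> card E = 2 \<and> (\<forall>m\<in>E. lyapunov_stable H j1 j2 m)"
    if j: "j1 > 0" "j2 < j1" "j2 \<noteq> - j1"
  proof -
    have "w \<in> E \<longleftrightarrow> w \<in> R" for w
      using tangency_zero_iff[OF j(1,2), of l "w $ 3"] j(3) unfolding R_def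
      by (cases "w $ 2 = 0") (auto simp: E)
    then have ER: "E = R" by blast
    obtain m z where "m > 0" "tangency j1 j2 l m z" using tangency_exists_smooth[OF j] by blast
    moreover obtain m' z' where "m' > 0" "tangency j1 j2 (- l) m' z'"
      using tangency_exists_smooth[OF j] by blast
    ultimately have "card R = 2"
      unfolding R_def using j by (intro card_regular_tangencies[of j2 j1 l m z "- m'" z']) (auto simp: tangency_mirror)
    moreover have "smooth_sphere M"
      unfolding smooth_sphere_def M_def
      using topological_sphere_reduced_space[OF j(1,2)] smooth_surface_at_reduced_space[OF j(1,2)] j(3)
      by blast
    ultimately show ?thesis using stable[OF j(1,2)] ER by simp
  qed
  have singular: "s \<in> E" "E - {s} = R" if j: "- j2 = j1" "j1 > 0"
  proof -
    have j': "j2 = - j1" "j2 < j1" using j by auto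
    note zero = tangency_zero_iff[OF j(2) j'(2), of l]
    show "s \<in> E" using E zero j'(1) by (simp add: s_def)
    have "w = s \<longleftrightarrow> w $ 1 = 0 \<and> w $ 2 = 0 \<and> w $ 3 = j1" for w
      by (simp add: s_def vec_eq_iff forall_3)
    then have "w \<in> E - {s} \<longleftrightarrow> w \<in> R" for w
      using zero j'(1) unfolding R_def by (cases "w $ 2 = 0") (auto simp: E)
    then show "E - {s} = R" by blast
  qed
  have l2: "l\<^sup>2 < 16 * j1 \<longleftrightarrow> a\<^sup>2 < 4 * \<kappa>\<^sup>2 * j1"
    using assms(2) by (simp add: l_def power_divide power_mult_distrib field_simps)
  have unstable: "\<not> lyapunov_stable H j1 j2 s \<and> (\<exists>!X. homoclinic_orbit H j1 j2 s X) \<and> card (E - {s}) = 2"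
    if j: "- j2 = j1" "j1 > 0" and a: "a\<^sup>2 < 4 * \<kappa>\<^sup>2 * j1"
  proof -
    have j2: "j2 = - j1" "j2 < j1" using j by auto
    have l: "l\<^sup>2 < 16 * j1" using a l2 by blast
    define b where "b = sqrt (16 * j1 - l\<^sup>2)"
    have b: "b > 0" "b\<^sup>2 = 16 * j1 - l\<^sup>2" using l by (simp_all add: b_def)
    have ex1: "\<exists>!X. homoclinic_orbit H j1 j2 s X"
      unfolding H s_def j2(1) homoclinic_orbit_iff[OF assms(2) j(2) l_def b] by simp
    then obtain X where "homoclinic_orbit H j1 j2 s X" by (elim ex1E)
    then have "\<not> lyapunov_stable H j1 j2 s" unfolding H by (rule homoclinic_unstable)
    moreover have "\<bar>l\<bar> < 4 * sqrt j1"
      using real_sqrt_less_mono[OF l] by (simp add: real_sqrt_mult)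
    then have "l < 4 * sqrt j1" "- l < 4 * sqrt j1" by auto
    then obtain m z m' z' where "m > 0" "tangency j1 j2 l m z" "m' > 0" "tangency j1 j2 (- l) m' z'"
      unfolding j2(1) using tangency_exists_conical[OF j(2)] by blast
    then have "card R = 2"
      unfolding R_def using j2 by (intro card_regular_tangencies[of j2 j1 l m z "- m'" z']) (auto simp: tangency_mirror)
    ultimately show ?thesis using ex1 singular(2)[OF j] by simp
  qed
  have apex: "lyapunov_stable H j1 j2 s \<and> card E = 2"
    if j: "- j2 = j1" "j1 > 0" and a: "a\<^sup>2 \<ge> 4 * \<kappa>\<^sup>2 * j1"
  proof -
    have j2: "j2 = - j1" using j by auto
    have l: "l\<^sup>2 \<ge> 16 * j1" using a l2 by linarith
    have "lyapunov_stable H j1 j2 s"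
      unfolding H s_def j2 by (rule lyapunov_stable_apex[OF j(2) \<kappa> l[unfolded l_def]])
    moreover have "card (E - {s}) = 1"
      unfolding singular(2)[OF j] R_def j2 by (rule card_regular_tangencies_apex[OF j(2) l])
    then have "card E = 2"
      using card.remove[of E s] singular(1)[OF j] card_ge_0_finite[of "E - {s}"] by simp
    ultimately show ?thesis by blast
  qed
  have off_apex: "lyapunov_stable H j1 j2 m" if "- j2 = j1" "j1 > 0" "m \<in> E - {s}" for m
    using stable[of m] singular(2)[OF that(1,2)] that by auto
  show ?thesis
    unfolding Let_def H_def[symmetric] M_def[symmetric] E_def[symmetric] s_def[symmetric]
  proof (intro conjI)
    show "\<forall>c. reduced_trajectory H j1 j2 c \<longrightarrow> (\<exists>C. range c \<subseteq> M \<inter> {w. \<kappa> / 2 * w$2 + a * w$3 = C})"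
      using planes by blast
    show "j1 > 0 \<and> j2 < j1 \<and> j2 \<noteq> - j1 \<longrightarrow>
        smooth_sphere M \<and> card E = 2 \<and> (\<forall>m\<in>E. lyapunov_stable H j1 j2 m)"
      using regular by blast
    show "- j2 = j1 \<and> j1 > 0 \<longrightarrow> sphere_with_conical_singularity M s"
      using sphere_with_conical_singularity_reduced_space[of j1] unfolding M_def s_def by auto
    show "- j2 = j1 \<and> j1 > 0 \<and> a\<^sup>2 < 4 * \<kappa>\<^sup>2 * j1 \<longrightarrow>
        s \<in> E \<and> \<not> lyapunov_stable H j1 j2 s \<and> (\<exists>!X. homoclinic_orbit H j1 j2 s X)
          \<and> card (E - {s}) = 2 \<and> (\<forall>m\<in>E - {s}. lyapunov_stable H j1 j2 m)"
      using singular(1) unstable off_apex by (intro impI; elim conjE) metis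
    show "- j2 = j1 \<and> j1 > 0 \<and> a\<^sup>2 \<ge> 4 * \<kappa>\<^sup>2 * j1 \<longrightarrow>
        card E = 2 \<and> s \<in> E \<and> (\<forall>m\<in>E. lyapunov_stable H j1 j2 m)"
      using singular(1) apex off_apex by (intro impI; elim conjE) (metis Diff_iff singletonD)
  qed
qed

end
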